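(* Let $n\ge 3$. Suppose that the values of $\mathcal{P}_{n,G}$, for $G$ a connected graph on $n$ nodes with at most $\left\lfloor \frac{1}{2}\binom{n}{2}\right\rfloor$ edges, can be deduced from the values of $\mathcal{P}_{n,H}$ for $H$ ranging over the finite graphs (without isolated vertex) on at most $n-1$ nodes; that is, suppose that whenever two graphs $X,Y$ on $n$ nodes satisfy $\mathcal{P}_{n,H}(X)=\mathcal{P}_{n,H}(Y)$ for all such $H$, they satisfy $\mathcal{P}_{n,G}(X)=\mathcal{P}_{n,G}(Y)$ for all such $G$. Then finite graphs on $n$ nodes are reconstructible.
   Context: Graphs are finite, undirected, without loops or multiple edges. $\mathbb{K}$ is a field of characteristic $0$. Let $x_{ij}$, for integers $0<i<j$, be commuting variables; infinite formal sums of monomials are allowed. Reconstructibility: for a graph $X$ on $n\ge 3$ nodes, its multiset of vertex-deleted subgraphs is the multiset $\{X_1,\dots,X_n\}$ of isomorphism classes of the $n$ induced subgraphs obtained by deleting exactly one vertex. Graphs on $n$ nodes are reconstructible if any two graphs on $n$ nodes having the same multiset of vertex-deleted subgraphs are isomorphic. Action: for $\sigma \in \mathfrak{S}_m$ and $1\le i<j\le m$, $\sigma\cdot(i,j) := (\min(\sigma(i),\sigma(j)),\max(\sigma(i),\sigma(j)))$. Definition of $\mathcal{M}_G$: let $G$ be a graph on $m\ge 2$ vertices without isolated vertex. Choose any labeling of the vertices of $G$ by $1,\dots,m$ and let $a_{ij}\in\{0,1\}$ ($1\le i<j\le m$) be $1$ if and only if $i$ and $j$ are adjacent. Let $R\subset\mathfrak{S}_m$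 be a set of permutations such that the families $(a_{\sigma\cdot(i,j)})_{1\le i<j\le m}$, $\sigma\in R$, are pairwise distinct and exhaust all the families obtained for $\sigma\in\mathfrak{S}_m$. Then $$\mathcal{M}_G := \sum_{0<r_1<\dots<r_m}\ \sum_{\sigma\in R}\ \prod_{1\le i<j\le m} x_{r_i r_j}^{a_{\sigma\cdot(i,j)}} .$$ By convention the one-vertex graph $\bullet$ counts as a graph without isolated vertex, and $\mathcal{M}_\bullet:=1$. $\mathcal{P}_{n,G}\in\mathbb{K}[x_{ij}\mid 1\le i<j\le n]$ is the polynomial obtained from $\mathcal{M}_G$ by setting to $0$ every variable having an index greater than $n$. Evaluation: for a graph $X$ on $n$ vertices, choose a labeling of its vertices by $1,\dots,n$ and put $b_{ij}=1$ if $i<j$ are adjacent in $X$ and $b_{ij}=0$ otherwise; $\mathcal{P}_{n,G}(X)$ is the value at $x_{ij}=b_{ij}$, which does not depend on the labeling. *)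

theory Defs
  imports "HOL-Library.FuncSet" "HOL-Library.Multiset" "HOL-Library.Poly_Mapping"
    "HOL-Combinatorics.Permutations"
begin

section \<open>Simple graphs\<close>

text \<open>Vertices are natural numbers, so that a statement can quantify over all finite graphs;
  the vertex set is an arbitrary finite set, not necessarily an initial segment.\<close>

type_synonym graph = "nat set \<times> nat set set"

abbreviation verts :: "graph \<Rightarrow> nat set" where "verts \<equiv> fst"
abbreviation edges :: "graph \<Rightarrow> nat set set" where "edges \<equiv> snd"

definition simple_graph :: "graph \<Rightarrow> bool" where
  "simple_graph G \<longleftrightarrow> finite (verts G) \<and> (\<forall>e\<in>edges G. e \<subseteq> verts G \<and> card e = 2)"

definition graph_on :: "nat \<Rightarrow> graph \<Rightarrow> bool" where
  "graph_on n G \<longleftrightarrow> simple_graph G \<and> card (verts G) = n"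

definition isomorphic :: "graph \<Rightarrow> graph \<Rightarrow> bool" where
  "isomorphic G H \<longleftrightarrow> (\<exists>f. bij_betw f (verts G) (verts H) \<and>
     (\<forall>u\<in>verts G. \<forall>v\<in>verts G. {u, v} \<in> edges G \<longleftrightarrow> {f u, f v} \<in> edges H))"

definition iso_class :: "graph \<Rightarrow> graph set" where
  "iso_class G = {H. simple_graph H \<and> isomorphic G H}"

definition connected_graph :: "graph \<Rightarrow> bool" where
  "connected_graph G \<longleftrightarrow> verts G \<noteq> {} \<and>
     (\<forall>u\<in>verts G. \<forall>v\<in>verts G. (u, v) \<in> {(x, y). {x, y} \<in> edges G}\<^sup>*)"

text \<open>The one-vertex graph counts as a graph without isolated vertex; the graph with no vertices
  is excluded.\<close>

definition no_isolated_vertex :: "graph \<Rightarrow> bool" where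
  "no_isolated_vertex G \<longleftrightarrow>
     card (verts G) = 1 \<or> card (verts G) \<ge> 2 \<and> (\<forall>v\<in>verts G. \<exists>e\<in>edges G. v \<in> e)"

section \<open>Reconstructibility\<close>

definition delete_vertex :: "graph \<Rightarrow> nat \<Rightarrow> graph" where
  "delete_vertex G v = (verts G - {v}, {e \<in> edges G. v \<notin> e})"

definition deck :: "graph \<Rightarrow> graph set multiset" where
  "deck G = image_mset (\<lambda>v. iso_class (delete_vertex G v)) (mset_set (verts G))"

definition reconstructible :: "nat \<Rightarrow> bool" where
  "reconstructible n \<longleftrightarrow>
     (\<forall>X Y. graph_on n X \<and> graph_on n Y \<and> deck X = deck Y \<longrightarrow> isomorphic X Y)"

section \<open>Labelings and the action of permutations on pairs\<close>

definition index_pairs :: "nat \<Rightarrow> (nat \<times> nat) set" where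
  "index_pairs m = {(i, j). 1 \<le> i \<and> i < j \<and> j \<le> m}"

definition labeling :: "graph \<Rightarrow> nat \<Rightarrow> nat" where
  "labeling G = (SOME f. bij_betw f {1..card (verts G)} (verts G))"

definition adj_entry :: "graph \<Rightarrow> nat \<times> nat \<Rightarrow> nat" where
  "adj_entry G = (\<lambda>(i, j). if {labeling G i, labeling G j} \<in> edges G then 1 else 0)"

definition pair_act :: "(nat \<Rightarrow> nat) \<Rightarrow> nat \<times> nat \<Rightarrow> nat \<times> nat" where
  "pair_act \<sigma> = (\<lambda>(i, j). (min (\<sigma> i) (\<sigma> j), max (\<sigma> i) (\<sigma> j)))"

definition permuted_family ::
    "nat \<Rightarrow> (nat \<times> nat \<Rightarrow> nat) \<Rightarrow> (nat \<Rightarrow> nat) \<Rightarrow> nat \<times> nat \<Rightarrow> nat" where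
  "permuted_family m a \<sigma> = (\<lambda>p\<in>index_pairs m. a (pair_act \<sigma> p))"

definition is_transversal :: "nat \<Rightarrow> (nat \<times> nat \<Rightarrow> nat) \<Rightarrow> (nat \<Rightarrow> nat) set \<Rightarrow> bool" where
  "is_transversal m a R \<longleftrightarrow> R \<subseteq> {\<sigma>. \<sigma> permutes {1..m}} \<and> inj_on (permuted_family m a) R \<and>
     permuted_family m a ` R = permuted_family m a ` {\<sigma>. \<sigma> permutes {1..m}}"

definition transversal :: "nat \<Rightarrow> (nat \<times> nat \<Rightarrow> nat) \<Rightarrow> (nat \<Rightarrow> nat) set" where
  "transversal m a = (SOME R. is_transversal m a R)"

section \<open>Polynomials and formal sums in the variables \<open>x\<^sub>i\<^sub>j\<close>\<close>

text \<open>The variable \<open>x\<^sub>i\<^sub>j\<close> is represented by the pair \<open>(i, j)\<close> and a monomial by its exponents.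
  A formal sum, possibly infinite, is the function giving the coefficient of each monomial;
  polynomials are the finitely supported ones.\<close>

type_synonym monomial = "(nat \<times> nat) \<Rightarrow>\<^sub>0 nat"
type_synonym 'k formal_sum = "monomial \<Rightarrow> 'k"
type_synonym 'k polynomial = "monomial \<Rightarrow>\<^sub>0 'k"

definition poly_value :: "'k::field polynomial \<Rightarrow> (nat \<times> nat \<Rightarrow> 'k) \<Rightarrow> 'k" where
  "poly_value p b = (\<Sum>\<mu>\<in>Poly_Mapping.keys p. Poly_Mapping.lookup p \<mu> * (\<Prod>v\<in>Poly_Mapping.keys \<mu>. b v ^ Poly_Mapping.lookup \<mu> v))"

text \<open>Setting to \<open>0\<close> every variable with an index greater than \<open>n\<close> erases exactly the monomials
  containing such a variable.\<close>

definition set_zero_above :: "nat \<Rightarrow> 'k::field formal_sum \<Rightarrow> 'k formal_sum" where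
  "set_zero_above n F = (\<lambda>\<mu>. if \<forall>(i, j)\<in>Poly_Mapping.keys \<mu>. i \<le> n \<and> j \<le> n then F \<mu> else 0)"

section \<open>The formal sums \<open>M\<^sub>G\<close> and the polynomials \<open>P\<^sub>n\<^sub>,\<^sub>G\<close>\<close>

definition increasing_seqs :: "nat \<Rightarrow> (nat \<Rightarrow> nat) set" where
  "increasing_seqs m = {r \<in> {1..m} \<rightarrow>\<^sub>E {0<..}. strict_mono_on {1..m} r}"

definition M_term :: "nat \<Rightarrow> (nat \<times> nat \<Rightarrow> nat) \<Rightarrow> (nat \<Rightarrow> nat) \<Rightarrow> (nat \<Rightarrow> nat) \<Rightarrow> monomial" where
  "M_term m a r \<sigma> =
     (\<Sum>(i, j)\<in>index_pairs m. Poly_Mapping.single (r i, r j) (a (pair_act \<sigma> (i, j))))"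

text \<open>The coefficient of \<open>\<mu>\<close> in the double sum over \<open>r\<close> and \<open>\<sigma>\<close> is the number of its terms
  equal to \<open>\<mu>\<close>. This number is finite for graphs without isolated vertex (lemma
  \<open>finite_M_index\<close>), which are the only ones for which \<open>M_sum\<close> is meaningful.\<close>

definition M_index :: "graph \<Rightarrow> monomial \<Rightarrow> ((nat \<Rightarrow> nat) \<times> (nat \<Rightarrow> nat)) set" where
  "M_index G \<mu> = (let m = card (verts G); a = adj_entry G in
     {(r, \<sigma>). r \<in> increasing_seqs m \<and> \<sigma> \<in> transversal m a \<and> M_term m a r \<sigma> = \<mu>})"

definition M_sum :: "graph \<Rightarrow> 'k::field formal_sum" where
  "M_sum G = (if card (verts G) = 1 then (\<lambda>\<mu>. if \<mu> = 0 then 1 else 0)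
     else (\<lambda>\<mu>. of_nat (card (M_index G \<mu>))))"

text \<open>The function under \<open>Abs_poly_mapping\<close> has finite support for graphs without isolated vertex
  (lemma \<open>lookup_P_poly\<close>).\<close>

definition P_poly :: "nat \<Rightarrow> graph \<Rightarrow> 'k::field polynomial" where
  "P_poly n G = Abs_poly_mapping (set_zero_above n (M_sum G))"

definition P_value :: "nat \<Rightarrow> graph \<Rightarrow> graph \<Rightarrow> 'k::field" where
  "P_value n G X = poly_value (P_poly n G) (\<lambda>v. of_nat (adj_entry X v))"

section \<open>The choices and the counts above are meaningful\<close>

lemma labeling_bij:
  assumes "simple_graph G"
  shows "bij_betw (labeling G) {1..card (verts G)} (verts G)"
proof -
  have "\<exists>f. bij_betw f {1..card (verts G)} (verts G)"
    using assms ex_bij_betw_nat_finite_1 unfolding simple_graph_def by blast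
  then show ?thesis unfolding labeling_def by (rule someI_ex)
qed

lemma transversal: "is_transversal m a (transversal m a)"
proof -
  let ?S = "{\<sigma>. \<sigma> permutes {1..m}}"
  have "\<exists>R\<subseteq>?S. inj_on (permuted_family m a) R \<and>
      permuted_family m a ` R = permuted_family m a ` ?S"
    by (metis (no_types, lifting) subset_image_inj subset_refl)
  then have "\<exists>R. is_transversal m a R"
    unfolding is_transversal_def by blast
  then show ?thesis unfolding transversal_def by (rule someI_ex)
qed

lemma finite_index_pairs: "finite (index_pairs m)"
  by (rule finite_subset[of _ "{1..m} \<times> {1..m}"]) (auto simp: index_pairs_def)

lemma keys_M_term:
  "Poly_Mapping.keys (M_term m a r \<sigma>) \<subseteq> {(r i, r j) | i j. (i, j) \<in> index_pairs m \<and> a (pair_act \<sigma> (i, j)) \<noteq> 0}"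
proof -
  have "Poly_Mapping.keys (M_term m a r \<sigma>) \<subseteq> (\<Union>p\<in>index_pairs m.
      Poly_Mapping.keys (case p of (i, j) \<Rightarrow> Poly_Mapping.single (r i, r j) (a (pair_act \<sigma> (i, j)))))"
    unfolding M_term_def by (rule keys_sum)
  then show ?thesis by (force split: if_splits)
qed

lemma lookup_M_term:
  assumes "(i, j) \<in> index_pairs m" "a (pair_act \<sigma> (i, j)) \<noteq> 0"
  shows "(r i, r j) \<in> Poly_Mapping.keys (M_term m a r \<sigma>)"
proof -
  have "Poly_Mapping.lookup (M_term m a r \<sigma>) (r i, r j) = (\<Sum>p\<in>index_pairs m.
      Poly_Mapping.lookup (case p of (i, j) \<Rightarrow> Poly_Mapping.single (r i, r j) (a (pair_act \<sigma> (i, j)))) (r i, r j))"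
    unfolding M_term_def by (rule lookup_sum)
  also have "\<dots> \<ge> Poly_Mapping.lookup (case (i, j) of (i, j) \<Rightarrow>
      Poly_Mapping.single (r i, r j) (a (pair_act \<sigma> (i, j)))) (r i, r j)"
    using assms(1) finite_index_pairs by (intro member_le_sum) auto
  finally show ?thesis using assms(2) by (simp add: in_keys_iff)
qed

lemma M_term_covers:
  assumes G: "simple_graph G" "no_isolated_vertex G" "card (verts G) \<noteq> 1"
    and \<sigma>: "\<sigma> permutes {1..card (verts G)}" and k: "k \<in> {1..card (verts G)}"
  shows "r k \<in> fst ` Poly_Mapping.keys (M_term (card (verts G)) (adj_entry G) r \<sigma>) \<union>
    snd ` Poly_Mapping.keys (M_term (card (verts G)) (adj_entry G) r \<sigma>)"
proof -
  let ?m = "card (verts G)" and ?f = "labeling G"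
  have f: "bij_betw ?f {1..?m} (verts G)" by (rule labeling_bij[OF G(1)])
  have \<sigma>k: "\<sigma> k \<in> {1..?m}" using permutes_in_image[OF \<sigma>] k by blast
  then have v: "?f (\<sigma> k) \<in> verts G" using f by (meson bij_betw_apply)
  with G obtain e where e: "e \<in> edges G" "?f (\<sigma> k) \<in> e"
    unfolding no_isolated_vertex_def by blast
  with G(1) have e2: "card e = 2" "e \<subseteq> verts G" by (auto simp: simple_graph_def)
  then obtain w where w: "e = {?f (\<sigma> k), w}" "w \<noteq> ?f (\<sigma> k)"
    using e(2) by (auto simp: card_2_iff)
  with e2 have "w \<in> verts G" by auto
  then obtain l' where l': "l' \<in> {1..?m}" "w = ?f l'"
    using f by (metis bij_betw_imp_surj_on imageE)
  then obtain l where l: "l \<in> {1..?m}" "l' = \<sigma> l" using permutes_image[OF \<sigma>] by blast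
  have "k \<noteq> l" using w l' l by auto
  then consider "k < l" | "l < k" by linarith
  then show ?thesis
  proof cases
    case 1
    then have "(r k, r l) \<in> Poly_Mapping.keys (M_term ?m (adj_entry G) r \<sigma>)"
      using k l e w l' by (intro lookup_M_term)
        (auto simp: index_pairs_def pair_act_def adj_entry_def min_def max_def insert_commute)
    then show ?thesis by force
  next
    case 2
    then have "(r l, r k) \<in> Poly_Mapping.keys (M_term ?m (adj_entry G) r \<sigma>)"
      using k l e w l' by (intro lookup_M_term)
        (auto simp: index_pairs_def pair_act_def adj_entry_def min_def max_def insert_commute)
    then show ?thesis by force
  qed
qed

lemma finite_transversal: "finite (transversal m a)"
proof -
  have "transversal m a \<subseteq> {\<sigma>. \<sigma> permutes {1..m}}"
    using transversal unfolding is_transversal_def by blast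
  then show ?thesis by (rule finite_subset) (simp add: finite_permutations)
qed

lemma M_index_bounded:
  assumes G: "simple_graph G" "no_isolated_vertex G" "card (verts G) \<noteq> 1"
    and n: "\<forall>(i, j)\<in>Poly_Mapping.keys \<mu>. i \<le> n \<and> j \<le> n"
  shows "M_index G \<mu> \<subseteq> ({1..card (verts G)} \<rightarrow>\<^sub>E {..n}) \<times> transversal (card (verts G)) (adj_entry G)"
proof
  fix x assume "x \<in> M_index G \<mu>"
  then obtain r \<sigma> where x: "x = (r, \<sigma>)" "r \<in> increasing_seqs (card (verts G))"
      "\<sigma> \<in> transversal (card (verts G)) (adj_entry G)"
      "M_term (card (verts G)) (adj_entry G) r \<sigma> = \<mu>"
    unfolding M_index_def Let_def by auto
  from x(3) have \<sigma>: "\<sigma> permutes {1..card (verts G)}"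
    using transversal unfolding is_transversal_def by blast
  have "r k \<le> n" if "k \<in> {1..card (verts G)}" for k
    using M_term_covers[OF G \<sigma> that, of r] n unfolding x(4) by fastforce
  then show "x \<in> ({1..card (verts G)} \<rightarrow>\<^sub>E {..n}) \<times> transversal (card (verts G)) (adj_entry G)"
    using x by (auto simp: increasing_seqs_def PiE_iff)
qed

lemma finite_M_index:
  assumes G: "simple_graph G" "no_isolated_vertex G" "card (verts G) \<noteq> 1"
  shows "finite (M_index G \<mu>)"
proof -
  let ?n = "Max (insert 0 (fst ` Poly_Mapping.keys \<mu> \<union> snd ` Poly_Mapping.keys \<mu>))"
  have "\<forall>(i, j)\<in>Poly_Mapping.keys \<mu>. i \<le> ?n \<and> j \<le> ?n" by (force intro!: Max_ge)
  from M_index_bounded[OF G this] show ?thesis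
    by (rule finite_subset) (intro finite_cartesian_product finite_PiE finite_transversal; simp)
qed

lemma lookup_P_poly:
  assumes G: "simple_graph G" "no_isolated_vertex G"
  shows "Poly_Mapping.lookup (P_poly n G :: 'k::field polynomial) = set_zero_above n (M_sum G)"
proof -
  let ?F = "set_zero_above n (M_sum G) :: 'k formal_sum"
  have "finite {\<mu>. ?F \<mu> \<noteq> 0}"
  proof (cases "card (verts G) = 1")
    case True
    then have "{\<mu>. ?F \<mu> \<noteq> 0} \<subseteq> {0}" by (auto simp: set_zero_above_def M_sum_def split: if_splits)
    then show ?thesis by (rule finite_subset) simp
  next
    case False
    let ?B = "({1..card (verts G)} \<rightarrow>\<^sub>E {..n}) \<times> transversal (card (verts G)) (adj_entry G)"
    have "{\<mu>. ?F \<mu> \<noteq> 0} \<subseteq> (\<lambda>(r, \<sigma>). M_term (card (verts G)) (adj_entry G) r \<sigma>) ` ?B"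
    proof
      fix \<mu> assume "\<mu> \<in> {\<mu>. ?F \<mu> \<noteq> 0}"
      then have n: "\<forall>(i, j)\<in>Poly_Mapping.keys \<mu>. i \<le> n \<and> j \<le> n" and "(M_sum G \<mu> :: 'k) \<noteq> 0"
        by (auto simp: set_zero_above_def split: if_splits)
      then have "M_index G \<mu> \<noteq> {}" using False by (auto simp: M_sum_def)
      then obtain r \<sigma> where i: "(r, \<sigma>) \<in> M_index G \<mu>" by auto
      then have "(r, \<sigma>) \<in> ?B" using M_index_bounded[OF G False n] by blast
      moreover have "\<mu> = M_term (card (verts G)) (adj_entry G) r \<sigma>"
        using i by (auto simp: M_index_def Let_def)
      ultimately show "\<mu> \<in> (\<lambda>(r, \<sigma>). M_term (card (verts G)) (adj_entry G) r \<sigma>) ` ?B" by force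
    qed
    moreover have "finite ?B"
      by (intro finite_cartesian_product finite_PiE finite_transversal; simp)
    ultimately show ?thesis by (rule finite_subset[OF _ finite_imageI])
  qed
  then show ?thesis unfolding P_poly_def by (simp add: Abs_poly_mapping_inverse)
qed

end

theory Submission
  imports Defs Complex_Main "HOL-Library.Infinite_Set"
begin

text \<open>The value \<open>P\<^sub>n\<^sub>,\<^sub>H(X)\<close> is the number of subgraphs of \<open>X\<close> isomorphic to \<open>H\<close>. By Kelly's
  lemma the deck determines it as soon as \<open>H\<close> has fewer than \<open>n\<close> vertices, so for two graphs with
  the same deck the hypothesis applies. A connected \<open>X\<close> with at most half of all edges can then
  itself be taken as \<open>G\<close>: the other graph contains a copy of \<open>X\<close>, and it has as many edges as \<open>X\<close>.
  A disconnected \<open>X\<close> is reconstructible unconditionally, by counting the pairs of induced copies of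
  its two parts that cover all vertices. A graph with more than half of all edges is replaced by its
  complement, whose deck consists of the complements of the cards.\<close>

section \<open>Isomorphisms and induced subgraphs\<close>

text \<open>Edges are doubletons of vertices, and a map injective on vertices is injective on sets
  of vertices, so preserving adjacency in both directions amounts to mapping one edge set onto the
  other. The image form suits counting edges and restricting to vertex subsets.\<close>

lemma isomorphic_iff_image:
  assumes "simple_graph G" "simple_graph H"
  shows "isomorphic G H \<longleftrightarrow>
    (\<exists>f. bij_betw f (verts G) (verts H) \<and> edges H = (`) f ` edges G)"
proof -
  have "(\<forall>u\<in>verts G. \<forall>v\<in>verts G. {u, v} \<in> edges G \<longleftrightarrow> {f u, f v} \<in> edges H) \<longleftrightarrow>
      edges H = (`) f ` edges G" if f: "bij_betw f (verts G) (verts H)" for f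
  proof
    assume *: "\<forall>u\<in>verts G. \<forall>v\<in>verts G. {u, v} \<in> edges G \<longleftrightarrow> {f u, f v} \<in> edges H"
    show "edges H = (`) f ` edges G"
    proof (intro equalityI subsetI)
      fix e assume e: "e \<in> edges H"
      then obtain a b where ab: "e = {a, b}" "a \<in> verts H" "b \<in> verts H"
        using assms(2) by (auto simp: simple_graph_def card_2_iff)
      then obtain u v where "u \<in> verts G" "v \<in> verts G" "a = f u" "b = f v"
        using f by (metis bij_betw_imp_surj_on imageE)
      with * e ab have "{u, v} \<in> edges G" "e = f ` {u, v}" by auto
      then show "e \<in> (`) f ` edges G" by blast
    next
      fix e assume "e \<in> (`) f ` edges G"
      then obtain d where d: "d \<in> edges G" "e = f ` d" by blast
      then obtain a b where "d = {a, b}" "a \<in> verts G" "b \<in> verts G"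
        using assms(1) by (auto simp: simple_graph_def card_2_iff)
      with * d show "e \<in> edges H" by auto
    qed
  next
    assume *: "edges H = (`) f ` edges G"
    show "\<forall>u\<in>verts G. \<forall>v\<in>verts G. {u, v} \<in> edges G \<longleftrightarrow> {f u, f v} \<in> edges H"
    proof (intro ballI iffI)
      fix u v assume uv: "u \<in> verts G" "v \<in> verts G"
      { assume "{u, v} \<in> edges G"
        then show "{f u, f v} \<in> edges H" using * by (auto intro: image_eqI[of _ _ "{u, v}"]) }
      { assume "{f u, f v} \<in> edges H"
        then obtain d where d: "d \<in> edges G" "f ` {u, v} = f ` d" using * by auto
        moreover have "d \<subseteq> verts G" using d assms(1) by (auto simp: simple_graph_def)
        ultimately have "{u, v} = d"
          using inj_on_image_eq_iff[of f "verts G" "{u, v}" d] f uv by (simp add: bij_betw_def)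
        with d show "{u, v} \<in> edges G" by simp }
    qed
  qed
  then show ?thesis unfolding isomorphic_def by blast
qed

lemma isomorphic_refl: "isomorphic G G"
  unfolding isomorphic_def by (intro exI[of _ id]) auto

lemma isomorphic_sym:
  assumes "isomorphic G H"
  shows "isomorphic H G"
proof -
  obtain f where f: "bij_betw f (verts G) (verts H)"
    and e: "\<forall>u\<in>verts G. \<forall>v\<in>verts G. {u, v} \<in> edges G \<longleftrightarrow> {f u, f v} \<in> edges H"
    using assms unfolding isomorphic_def by blast
  have "{u, v} \<in> edges H \<longleftrightarrow> {inv_into (verts G) f u, inv_into (verts G) f v} \<in> edges G"
    if "u \<in> verts H" "v \<in> verts H" for u v
    using that e bij_betw_inv_into_right[OF f] bij_betw_apply[OF bij_betw_inv_into[OF f]] by simp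
  then show ?thesis
    unfolding isomorphic_def using bij_betw_inv_into[OF f] by blast
qed

lemma isomorphic_trans:
  assumes "isomorphic G H" "isomorphic H K"
  shows "isomorphic G K"
proof -
  obtain f where f: "bij_betw f (verts G) (verts H)"
    "\<forall>u\<in>verts G. \<forall>v\<in>verts G. {u, v} \<in> edges G \<longleftrightarrow> {f u, f v} \<in> edges H"
    using assms(1) unfolding isomorphic_def by blast
  obtain g where g: "bij_betw g (verts H) (verts K)"
    "\<forall>u\<in>verts H. \<forall>v\<in>verts H. {u, v} \<in> edges H \<longleftrightarrow> {g u, g v} \<in> edges K"
    using assms(2) unfolding isomorphic_def by blast
  have "\<forall>u\<in>verts G. \<forall>v\<in>verts G. {u, v} \<in> edges G \<longleftrightarrow> {(g \<circ> f) u, (g \<circ> f) v} \<in> edges K"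
    using f g by (simp add: bij_betw_apply)
  then show ?thesis
    unfolding isomorphic_def using bij_betw_trans[OF f(1) g(1)] by blast
qed

lemma isomorphic_card_verts: "isomorphic G H \<Longrightarrow> card (verts G) = card (verts H)"
  unfolding isomorphic_def using bij_betw_same_card by blast

lemma inj_on_image_edges:
  assumes "simple_graph G" "inj_on f (verts G)"
  shows "inj_on ((`) f) (edges G)"
proof (rule inj_on_subset[OF inj_on_image_Pow[OF assms(2)]])
  show "edges G \<subseteq> Pow (verts G)" using assms(1) by (auto simp: simple_graph_def)
qed

lemma isomorphic_card_edges:
  assumes "simple_graph G" "simple_graph H" "isomorphic G H"
  shows "card (edges G) = card (edges H)"
proof -
  obtain f where f: "bij_betw f (verts G) (verts H)" "edges H = (`) f ` edges G"
    using assms(3) isomorphic_iff_image[OF assms(1,2)] by blast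
  then show ?thesis
    using inj_on_image_edges[OF assms(1)] by (metis bij_betw_def card_image)
qed

lemma finite_edges: "simple_graph G \<Longrightarrow> finite (edges G)"
  unfolding simple_graph_def by (meson PowI finite_Pow_iff finite_subset subsetI)

section \<open>Induced subgraphs\<close>

definition induced :: "graph \<Rightarrow> nat set \<Rightarrow> graph" where
  "induced X W = (W, {e \<in> edges X. e \<subseteq> W})"

lemma verts_induced [simp]: "verts (induced X W) = W"
  and edges_induced: "edges (induced X W) = {e \<in> edges X. e \<subseteq> W}"
  by (simp_all add: induced_def)

lemma induced_induced [simp]: "U \<subseteq> W \<Longrightarrow> induced (induced X W) U = induced X U"
  by (auto simp: induced_def)

lemma induced_verts [simp]: "simple_graph X \<Longrightarrow> induced X (verts X) = X"
  by (rule prod_eqI) (auto simp: induced_def simple_graph_def)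

lemma simple_induced [intro]:
  "simple_graph X \<Longrightarrow> W \<subseteq> verts X \<Longrightarrow> simple_graph (induced X W)"
  by (auto simp: induced_def simple_graph_def intro: finite_subset)

lemma delete_vertex_eq_induced:
  "simple_graph X \<Longrightarrow> delete_vertex X v = induced X (verts X - {v})"
  by (auto simp: induced_def delete_vertex_def simple_graph_def)

text \<open>Injectivity of \<open>f\<close> pulls an edge between \<open>f u\<close> and
  \<open>f v\<close> back to the edge between \<open>u\<close> and \<open>v\<close>, so the
  restriction of \<open>f\<close> to \<open>W\<close> is an isomorphism onto its image.\<close>

lemma isomorphic_induced:
  assumes "simple_graph X" "W \<subseteq> verts X" "inj_on f (verts X)" "edges Y = (`) f ` edges X"
  shows "isomorphic (induced X W) (induced Y (f ` W))"
proof -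
  have "{u, v} \<in> edges X \<longleftrightarrow> {f u, f v} \<in> edges Y" if "u \<in> W" "v \<in> W" for u v
  proof
    assume "{f u, f v} \<in> edges Y"
    then obtain d where d: "d \<in> edges X" "f ` {u, v} = f ` d" using assms(4) by auto
    moreover have "d \<subseteq> verts X" using d assms(1) by (auto simp: simple_graph_def)
    moreover have "{u, v} \<subseteq> verts X" using that assms(2) by auto
    ultimately have "{u, v} = d" using inj_on_image_eq_iff[OF assms(3)] by blast
    with d show "{u, v} \<in> edges X" by simp
  qed (auto simp: assms(4) intro: image_eqI[of _ _ "{u, v}"])
  moreover have "bij_betw f W (f ` W)"
    using assms(2,3) by (meson bij_betw_imageI inj_on_subset)
  ultimately show ?thesis
    unfolding isomorphic_def by (intro exI[of _ f]) (auto simp: edges_induced)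
qed

section \<open>Kelly's lemma\<close>

text \<open>Only simple graphs are compared, because \<open>isomorphic\<close> tests sets of at most
  two vertices and is blind to any other member of \<open>edges\<close>.\<close>

definition graph_invariant :: "(graph \<Rightarrow> 'a) \<Rightarrow> bool" where
  "graph_invariant g \<longleftrightarrow>
    (\<forall>G H. simple_graph G \<and> simple_graph H \<and> isomorphic G H \<longrightarrow> g G = g H)"

lemma graph_invariantD:
  "graph_invariant g \<Longrightarrow> simple_graph G \<Longrightarrow> simple_graph H \<Longrightarrow> isomorphic G H \<Longrightarrow> g G = g H"
  by (simp add: graph_invariant_def del: split_paired_All)

text \<open>An isomorphism maps vertex subsets bijectively to vertex subsets and keeps the types of
  the induced subgraphs, so it reindexes the sum.\<close>

lemma graph_invariant_sum_induced:
  fixes g :: "graph \<Rightarrow> 'a::comm_monoid_add"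
  assumes g: "graph_invariant g"
  shows "graph_invariant (\<lambda>X. \<Sum>W\<in>Pow (verts X). g (induced X W))"
  unfolding graph_invariant_def
proof (intro allI impI)
  fix X Y assume "simple_graph X \<and> simple_graph Y \<and> isomorphic X Y"
  then have X: "simple_graph X" and Y: "simple_graph Y" and "isomorphic X Y" by auto
  then obtain f where f: "bij_betw f (verts X) (verts Y)" "edges Y = (`) f ` edges X"
    using isomorphic_iff_image[OF X Y] by blast
  have "g (induced X W) = g (induced Y (f ` W))" if "W \<subseteq> verts X" for W
  proof (rule graph_invariantD[OF g])
    show "simple_graph (induced X W)" using X that by auto
    show "simple_graph (induced Y (f ` W))" 
      using Y that image_mono[OF that, of f] f(1) by (intro simple_induced) (auto simp: bij_betw_def)
    show "isomorphic (induced X W) (induced Y (f ` W))"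
      using X that f by (intro isomorphic_induced) (auto simp: bij_betw_def)
  qed
  then have "(\<Sum>W\<in>Pow (verts X). g (induced X W)) = (\<Sum>W\<in>Pow (verts X). g (induced Y (f ` W)))"
    by (intro sum.cong) auto
  also have "\<dots> = (\<Sum>W\<in>Pow (verts Y). g (induced Y W))"
    by (rule sum.reindex_bij_betw[OF bij_betw_Pow[OF f(1)]])
  finally show "(\<Sum>W\<in>Pow (verts X). g (induced X W)) = (\<Sum>W\<in>Pow (verts Y). g (induced Y W))" .
qed

lemma iso_class_self: "simple_graph G \<Longrightarrow> G \<in> iso_class G"
  by (simp add: iso_class_def isomorphic_refl)

lemma simple_delete_vertex: "simple_graph X \<Longrightarrow> simple_graph (delete_vertex X v)"
  by (simp add: delete_vertex_eq_induced simple_induced)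

text \<open>The deck stores isomorphism classes, so a card is read through an arbitrary
  representative; invariance of \<open>h\<close> makes the choice harmless. The left-hand side
  depends on the deck alone, which is how equality of decks is exploited.\<close>

lemma sum_mset_deck:
  fixes h :: "graph \<Rightarrow> 'a::comm_monoid_add"
  assumes h: "graph_invariant h" and X: "simple_graph X"
  shows "(\<Sum>C\<in>#deck X. h (SOME G. G \<in> C)) = (\<Sum>v\<in>verts X. h (delete_vertex X v))"
proof -
  have "h (SOME H. H \<in> iso_class G) = h G" if G: "simple_graph G" for G
  proof -
    have "(SOME H. H \<in> iso_class G) \<in> iso_class G"
      using iso_class_self[OF G] by (rule someI)
    then show ?thesis
      using graph_invariantD[OF h G] unfolding iso_class_def mem_Collect_eq by metis
  qed
  then show ?thesis
    by (simp add: deck_def sum_unfold_sum_mset image_mset.compositionality comp_def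
      simple_delete_vertex[OF X])
qed

text \<open>Weighting a proper vertex set \<open>W\<close> by \<open>1 / (n - |W|)\<close> compensates for the number of
  vertex-deleted subgraphs that contain it.\<close>

lemma kelly:
  fixes g :: "graph \<Rightarrow> real"
  assumes g: "graph_invariant g" and X: "graph_on n X" and Y: "graph_on n Y"
    and deck: "deck X = deck Y"
  shows "(\<Sum>W\<in>Pow (verts X) - {verts X}. g (induced X W)) =
    (\<Sum>W\<in>Pow (verts Y) - {verts Y}. g (induced Y W))"
proof -
  \<comment> \<open>The values of \<open>w\<close> that matter are those at subgraphs of cards,
    which have fewer than \<open>n\<close> vertices, so the denominator is positive there.\<close>
  define w where "w G = g G / real (n - card (verts G))" for G
  define h where "h G = (\<Sum>W\<in>Pow (verts G). w (induced G W))" for G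
  have "graph_invariant w"
    unfolding graph_invariant_def w_def
    using graph_invariantD[OF g] isomorphic_card_verts by metis
  then have h: "graph_invariant h"
    unfolding h_def by (rule graph_invariant_sum_induced)
  have "(\<Sum>W\<in>Pow (verts X) - {verts X}. g (induced X W)) =
      (\<Sum>C\<in>#deck X. h (SOME G. G \<in> C))" if "graph_on n X" for X
  proof -
    have X: "simple_graph X" "finite (verts X)" "card (verts X) = n"
      using that by (auto simp: graph_on_def simple_graph_def)
    have "(\<Sum>C\<in>#deck X. h (SOME G. G \<in> C)) = (\<Sum>v\<in>verts X. h (delete_vertex X v))"
      by (rule sum_mset_deck[OF h X(1)])
    \<comment> \<open>A set of vertices of a card is a proper subset of \<open>verts X\<close>
      avoiding the deleted vertex, and the card induces the same graph on it as \<open>X\<close>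
      does.\<close>
    also have "\<dots> = (\<Sum>v\<in>verts X. \<Sum>W | W \<in> Pow (verts X) - {verts X} \<and> v \<notin> W. w (induced X W))"
      unfolding h_def using X(1)
      by (intro sum.cong refl) (auto simp: delete_vertex_eq_induced subset_Diff_insert intro!: sum.cong)
    \<comment> \<open>Double counting: for fixed \<open>W\<close> the inner sum now runs over the
      vertices outside \<open>W\<close>, that is, over the cards containing it.\<close>
    also have "\<dots> = (\<Sum>W\<in>Pow (verts X) - {verts X}. \<Sum>v | v \<in> verts X \<and> v \<notin> W. w (induced X W))"
      using X by (intro sum.swap_restrict) auto
    also have "\<dots> = (\<Sum>W\<in>Pow (verts X) - {verts X}. g (induced X W))"
    proof (intro sum.cong refl)
      fix W assume W: "W \<in> Pow (verts X) - {verts X}"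
      then have "card W < n" using X by (metis DiffE PowD psubsetI psubset_card_mono singletonI)
      moreover have "card {v \<in> verts X. v \<notin> W} = n - card W"
        using W X by (metis DiffD1 PowD card_Diff_subset finite_subset set_diff_eq)
      ultimately show "(\<Sum>v | v \<in> verts X \<and> v \<notin> W. w (induced X W)) = g (induced X W)"
        by (simp add: w_def)
    qed
    finally show ?thesis by simp
  qed
  from this[OF X] this[OF Y] deck show ?thesis by simp
qed

text \<open>Kelly's lemma is applied to the indicator of a single edge: a vertex set contributes
  exactly when it is itself an edge. Since \<open>n\<close> is at least 3, every edge is a proper
  subset of the vertices and none is lost.\<close>

lemma deck_card_edges:
  assumes X: "graph_on n X" and Y: "graph_on n Y" and deck: "deck X = deck Y" and n: "n \<ge> 3"
  shows "card (edges X) = card (edges Y)"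
proof -
  define g :: "graph \<Rightarrow> real" where "g G = of_bool (verts G \<in> edges G)" for G
  have "graph_invariant g"
    unfolding graph_invariant_def g_def
  proof (intro allI impI)
    fix G H assume *: "simple_graph G \<and> simple_graph H \<and> isomorphic G H"
    then obtain f where f: "bij_betw f (verts G) (verts H)" "edges H = (`) f ` edges G"
      using isomorphic_iff_image[of G H] by blast
    have "verts H = f ` verts G" using f by (simp add: bij_betw_def)
    moreover have "verts G \<in> edges G" if "f ` verts G = f ` e" "e \<in> edges G" for e
    proof -
      have "e \<subseteq> verts G" using * that by (auto simp: simple_graph_def)
      then have "e = verts G" using that f by (metis bij_betw_def inj_on_image_eq_iff subset_refl)
      with that show ?thesis by simp
    qed
    ultimately have "verts G \<in> edges G \<longleftrightarrow> verts H \<in> edges H" using f(2) by auto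
    then show "(of_bool (verts G \<in> edges G) :: real) = of_bool (verts H \<in> edges H)" by simp
  qed
  moreover have "(\<Sum>W\<in>Pow (verts X) - {verts X}. g (induced X W)) = card (edges X)"
    if "graph_on n X" for X
  proof -
    have X: "simple_graph X" "card (verts X) = n" using that by (auto simp: graph_on_def)
    have "(\<Sum>W\<in>Pow (verts X) - {verts X}. g (induced X W)) = (\<Sum>W\<in>edges X. 1)"
      using X n
      by (intro sum.mono_neutral_cong_right) (auto simp: g_def edges_induced simple_graph_def)
    then show ?thesis by simp
  qed
  ultimately show ?thesis using kelly[OF _ X Y deck, of g] X Y by simp
qed

section \<open>Disconnected graphs\<close>

text \<open>Overlaps are allowed: every pair of copies is then a split pair of exactly one induced
  subgraph, the one on its union.\<close>

definition split_pairs :: "graph \<Rightarrow> graph \<Rightarrow> graph \<Rightarrow> (nat set \<times> nat set) set" where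
  "split_pairs P Q X = {(C, D). C \<union> D = verts X \<and>
     isomorphic (induced X C) P \<and> isomorphic (induced X D) Q}"

lemma isomorphic_cong:
  "isomorphic G H \<Longrightarrow> isomorphic G P \<longleftrightarrow> isomorphic H P"
  using isomorphic_sym isomorphic_trans by blast

text \<open>Taking images under an isomorphism preserves unions and the types of induced subgraphs,
  hence matches the split pairs of the two graphs bijectively.\<close>

lemma graph_invariant_card_split_pairs: "graph_invariant (\<lambda>X. card (split_pairs P Q X))"
  unfolding graph_invariant_def
proof (intro allI impI)
  fix X Y assume "simple_graph X \<and> simple_graph Y \<and> isomorphic X Y"
  then have X: "simple_graph X" and Y: "simple_graph Y" and "isomorphic X Y" by auto
  then obtain f where f: "bij_betw f (verts X) (verts Y)" "edges Y = (`) f ` edges X"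
    using isomorphic_iff_image[OF X Y] by blast
  have inj: "inj_on f (verts X)" and im: "f ` verts X = verts Y"
    using f(1) by (auto simp: bij_betw_def)
  have iso: "isomorphic (induced X C) K \<longleftrightarrow> isomorphic (induced Y (f ` C)) K" if "C \<subseteq> verts X" for C K
    by (rule isomorphic_cong[OF isomorphic_induced[OF X that inj f(2)]])
  have "bij_betw (map_prod ((`) f) ((`) f)) (split_pairs P Q X) (split_pairs P Q Y)"
  proof (rule bij_betw_imageI)
    have "inj_on (map_prod ((`) f) ((`) f)) (Pow (verts X) \<times> Pow (verts X))"
      by (rule map_prod_inj_on[OF inj_on_image_Pow[OF inj] inj_on_image_Pow[OF inj]])
    then show "inj_on (map_prod ((`) f) ((`) f)) (split_pairs P Q X)"
      by (rule inj_on_subset) (auto simp: split_pairs_def)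
    show "map_prod ((`) f) ((`) f) ` split_pairs P Q X = split_pairs P Q Y"
    proof (intro equalityI subsetI)
      fix p assume "p \<in> map_prod ((`) f) ((`) f) ` split_pairs P Q X"
      then obtain C D where CD: "(C, D) \<in> split_pairs P Q X" "p = (f ` C, f ` D)" by auto
      then have "C \<subseteq> verts X" "D \<subseteq> verts X" by (auto simp: split_pairs_def)
      with CD iso show "p \<in> split_pairs P Q Y"
        by (auto simp: split_pairs_def im[symmetric] image_Un[symmetric])
    next
      fix p assume "p \<in> split_pairs P Q Y"
      then obtain C' D' where p: "p = (C', D')" "(C', D') \<in> split_pairs P Q Y" by (cases p) auto
      then have "C' \<subseteq> f ` verts X" "D' \<subseteq> f ` verts X" by (auto simp: im split_pairs_def)
      then obtain C D where CD: "C' = f ` C" "D' = f ` D" "C \<subseteq> verts X" "D \<subseteq> verts X"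
        by (meson subset_imageE)
      have "f ` (C \<union> D) = f ` verts X" using p CD im by (simp add: split_pairs_def image_Un)
      then have "C \<union> D = verts X"
        using inj_on_image_eq_iff[OF inj, of "C \<union> D" "verts X"] CD by blast
      then have "(C, D) \<in> split_pairs P Q X" using p CD iso by (auto simp: split_pairs_def)
      with p CD show "p \<in> map_prod ((`) f) ((`) f) ` split_pairs P Q X" by force
    qed
  qed
  then show "card (split_pairs P Q X) = card (split_pairs P Q Y)" by (rule bij_betw_same_card)
qed

lemma graph_invariant_of_nat: "graph_invariant g \<Longrightarrow> graph_invariant (\<lambda>X. of_nat (g X))"
  unfolding graph_invariant_def by metis

text \<open>Kelly's lemma is applied to the indicator of being isomorphic to \<open>P\<close>. The
  whole vertex set, which that lemma omits, contributes nothing because \<open>P\<close> has fewer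
  than \<open>n\<close> vertices.\<close>

lemma deck_card_induced_copies:
  assumes X: "graph_on n X" and Y: "graph_on n Y" and deck: "deck X = deck Y"
    and P: "card (verts P) < n"
  shows "card {C \<in> Pow (verts X). isomorphic (induced X C) P} =
    card {C \<in> Pow (verts Y). isomorphic (induced Y C) P}"
proof -
  define g :: "graph \<Rightarrow> real" where "g G = of_bool (isomorphic G P)" for G
  have "graph_invariant g"
    unfolding graph_invariant_def
  proof (intro allI impI)
    fix G H assume "simple_graph G \<and> simple_graph H \<and> isomorphic G H"
    then show "g G = g H" using isomorphic_cong[of G H P] by (simp add: g_def)
  qed
  moreover have "(\<Sum>W\<in>Pow (verts X) - {verts X}. g (induced X W)) =
      card {C \<in> Pow (verts X). isomorphic (induced X C) P}" if X: "graph_on n X" for X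
  proof -
    have fin: "finite (verts X)" using X by (auto simp: graph_on_def simple_graph_def)
    have "\<not> isomorphic (induced X (verts X)) P"
      using isomorphic_card_verts[of "induced X (verts X)" P] X P by (auto simp: graph_on_def)
    then have "(\<Sum>W\<in>Pow (verts X) - {verts X}. g (induced X W)) =
        (\<Sum>W\<in>{C \<in> Pow (verts X). isomorphic (induced X C) P}. 1)"
      using fin by (intro sum.mono_neutral_cong_right) (auto simp: g_def)
    then show ?thesis by simp
  qed
  ultimately show ?thesis using kelly[OF _ X Y deck, of g] X Y by simp
qed

text \<open>Pairs of induced copies of \<open>P\<close> and \<open>Q\<close> are classified by their union; all unions except the
  whole vertex set are visible in the deck.\<close>

lemma deck_card_split_pairs:
  assumes X: "graph_on n X" and Y: "graph_on n Y" and deck: "deck X = deck Y"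
    and P: "card (verts P) < n" and Q: "card (verts Q) < n"
  shows "card (split_pairs P Q X) = card (split_pairs P Q Y)"
proof -
  let ?c = "\<lambda>P X. {C \<in> Pow (verts X). isomorphic (induced X C) P}"
  define g :: "graph \<Rightarrow> real" where "g G = of_nat (card (split_pairs P Q G))" for G
  have g: "graph_invariant g"
    unfolding g_def by (intro graph_invariant_of_nat graph_invariant_card_split_pairs)
  have "real (card (?c P X) * card (?c Q X)) =
      (\<Sum>W\<in>Pow (verts X) - {verts X}. g (induced X W)) + g X" if X: "graph_on n X" for X
  proof -
    have fin: "finite (verts X)" and simple: "simple_graph X"
      using X by (auto simp: graph_on_def simple_graph_def)
    have "?c P X \<times> ?c Q X = (\<Union>W\<in>Pow (verts X). split_pairs P Q (induced X W))"
      by (auto simp: split_pairs_def)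
    then have "card (?c P X) * card (?c Q X) =
        card (\<Union>W\<in>Pow (verts X). split_pairs P Q (induced X W))"
      by (simp only: card_cartesian_product[symmetric])
    also have "card (\<Union>W\<in>Pow (verts X). split_pairs P Q (induced X W)) =
        (\<Sum>W\<in>Pow (verts X). card (split_pairs P Q (induced X W)))"
    proof (rule card_UN_disjoint)
      show "\<forall>W\<in>Pow (verts X). finite (split_pairs P Q (induced X W))"
      proof
        fix W assume "W \<in> Pow (verts X)"
        then have "finite (Pow W \<times> Pow W)" using fin by (auto intro: finite_subset)
        then show "finite (split_pairs P Q (induced X W))"
          by (rule rev_finite_subset) (auto simp: split_pairs_def)
      qed
    qed (use fin in \<open>auto simp: split_pairs_def\<close>)
    finally have "card (?c P X) * card (?c Q X) =
        (\<Sum>W\<in>Pow (verts X). card (split_pairs P Q (induced X W)))" .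
    then have "real (card (?c P X) * card (?c Q X)) = (\<Sum>W\<in>Pow (verts X). g (induced X W))"
      by (simp add: g_def flip: of_nat_sum)
    also have "\<dots> = (\<Sum>W\<in>Pow (verts X) - {verts X}. g (induced X W)) + g X"
      using fin simple sum.remove[of "Pow (verts X)" "verts X" "\<lambda>W. g (induced X W)"] by simp
    finally show ?thesis .
  qed
  \<comment> \<open>In the identity above, the product and the sum over proper subsets agree for
    \<open>X\<close> and \<open>Y\<close>, so the last summand agrees too.\<close>
  from this[OF X] this[OF Y] kelly[OF g X Y deck]
    deck_card_induced_copies[OF X Y deck P] deck_card_induced_copies[OF X Y deck Q]
  show ?thesis by (simp add: g_def)
qed

text \<open>With no edge between the two parts on either side, the two isomorphisms are combined
  piecewise; disjointness makes the combined map bijective.\<close>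

lemma isomorphic_glue:
  assumes X: "simple_graph X" "verts X = A \<union> B" "A \<inter> B = {}"
    and eX: "edges X = edges (induced X A) \<union> edges (induced X B)"
    and Y: "simple_graph Y" "verts Y = C \<union> D" "C \<inter> D = {}"
    and eY: "edges Y = edges (induced Y C) \<union> edges (induced Y D)"
    and iso: "isomorphic (induced X A) (induced Y C)" "isomorphic (induced X B) (induced Y D)"
  shows "isomorphic X Y"
proof -
  have simple: "simple_graph (induced X A)" "simple_graph (induced X B)"
      "simple_graph (induced Y C)" "simple_graph (induced Y D)"
    using X Y by (auto intro!: simple_induced)
  obtain f where f: "bij_betw f A C" "edges (induced Y C) = (`) f ` edges (induced X A)"
    using isomorphic_iff_image[OF simple(1,3)] iso(1) by auto
  obtain g where g: "bij_betw g B D" "edges (induced Y D) = (`) g ` edges (induced X B)"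
    using isomorphic_iff_image[OF simple(2,4)] iso(2) by auto
  define h where "h x = (if x \<in> A then f x else g x)" for x
  have h: "h x = f x" if "x \<in> A" for x using that by (simp add: h_def)
  have h': "h x = g x" if "x \<in> B" for x using that X(3) by (auto simp: h_def)
  have "bij_betw h A C" using f(1) h by (simp cong: bij_betw_cong)
  moreover have "bij_betw h B D" using g(1) h' by (simp cong: bij_betw_cong)
  ultimately have "bij_betw h (verts X) (verts Y)"
    unfolding X(2) Y(2) using Y(3) by (intro bij_betw_combine)
  moreover have "edges Y = (`) h ` edges X"
  proof -
    have "(`) h ` edges (induced X A) = (`) f ` edges (induced X A)"
      by (intro image_cong refl) (auto simp: edges_induced intro!: image_cong h)
    moreover have "(`) h ` edges (induced X B) = (`) g ` edges (induced X B)"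
      by (intro image_cong refl) (auto simp: edges_induced intro!: image_cong h')
    ultimately show ?thesis unfolding eX eY image_Un f(2) g(2) by simp
  qed
  ultimately show ?thesis using isomorphic_iff_image[OF X(1) Y(1)] by blast
qed

text \<open>\<open>A\<close> is the set of vertices reachable from a vertex \<open>u\<close> that
  fails to reach some \<open>v\<close>, and \<open>B\<close> is the rest. Adjacency is symmetric, so
  either both ends of an edge are reachable from \<open>u\<close> or neither is.\<close>

lemma disconnected_split:
  assumes X: "simple_graph X" "verts X \<noteq> {}" "\<not> connected_graph X"
  obtains A B where "A \<noteq> {}" "B \<noteq> {}" "A \<inter> B = {}" "verts X = A \<union> B"
    "edges X = edges (induced X A) \<union> edges (induced X B)"
proof -
  let ?R = "{(x, y). {x, y} \<in> edges X}"
  obtain u v where uv: "u \<in> verts X" "v \<in> verts X" "(u, v) \<notin> ?R\<^sup>*"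
    using X by (auto simp: connected_graph_def)
  define A where "A = {w \<in> verts X. (u, w) \<in> ?R\<^sup>*}"
  have "e \<subseteq> A \<or> e \<subseteq> verts X - A" if e: "e \<in> edges X" for e
  proof -
    obtain a b where ab: "e = {a, b}" "a \<in> verts X" "b \<in> verts X"
      using X(1) e by (auto simp: simple_graph_def card_2_iff)
    then have "(a, b) \<in> ?R" "(b, a) \<in> ?R" using e by (auto simp: insert_commute)
    then have "(u, a) \<in> ?R\<^sup>* \<longleftrightarrow> (u, b) \<in> ?R\<^sup>*" by (meson rtrancl.rtrancl_into_rtrancl)
    with ab show ?thesis by (auto simp: A_def)
  qed
  then have "edges X = edges (induced X A) \<union> edges (induced X (verts X - A))"
    by (auto simp: edges_induced)
  moreover have "u \<in> A" "v \<in> verts X - A" using uv by (auto simp: A_def)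
  moreover have "A \<subseteq> verts X" by (auto simp: A_def)
  ultimately show thesis by (intro that[of A "verts X - A"]) blast+
qed

lemma edges_induced_disjoint:
  assumes "simple_graph X" "A \<inter> B = {}"
  shows "edges (induced X A) \<inter> edges (induced X B) = {}"
proof -
  have "e \<noteq> {}" if "e \<in> edges X" for e using that assms(1) by (auto simp: simple_graph_def)
  then show ?thesis using assms(2) by (force simp: edges_induced)
qed

text \<open>A partition of \<open>X\<close> without crossing edges is one of the split pairs counted
  by the deck, so \<open>Y\<close> has a split pair of the same types. Vertex and edge counts force
  this pair to be disjoint and free of crossing edges, and the two isomorphisms glue.\<close>

lemma disconnected_reconstructible:
  assumes X: "graph_on n X" and Y: "graph_on n Y" and deck: "deck X = deck Y" and n: "n \<ge> 3"
    and disc: "\<not> connected_graph X"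
  shows "isomorphic X Y"
proof -
  have sX: "simple_graph X" "card (verts X) = n" "finite (verts X)"
    and sY: "simple_graph Y" "card (verts Y) = n" "finite (verts Y)"
    using X Y by (auto simp: graph_on_def simple_graph_def)
  have ne: "verts X \<noteq> {}" using sX(2) n by auto
  obtain A B where AB: "A \<noteq> {}" "B \<noteq> {}" "A \<inter> B = {}" "verts X = A \<union> B"
      and eX: "edges X = edges (induced X A) \<union> edges (induced X B)"
    by (rule disconnected_split[OF sX(1) ne disc])
  have fin: "finite A" "finite B" using sX AB by auto
  then have cardAB: "card A + card B = n" "card A > 0" "card B > 0"
    using sX AB by (auto simp: card_Un_disjoint card_gt_0_iff)
  let ?S = "split_pairs (induced X A) (induced X B)"
  have "(A, B) \<in> ?S X" using AB by (simp add: split_pairs_def isomorphic_refl)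
  \<comment> \<open>Finiteness turns the existing pair into a nonzero count, since
    \<open>card\<close> of an infinite set is 0.\<close>
  moreover have "finite (?S X)"
    by (rule finite_subset[of _ "Pow (verts X) \<times> Pow (verts X)"])
      (auto simp: split_pairs_def sX)
  moreover have "card (?S X) = card (?S Y)"
    using cardAB by (intro deck_card_split_pairs[OF X Y deck]) auto
  ultimately have "card (?S Y) \<noteq> 0" by (metis card_0_eq empty_iff)
  then have "?S Y \<noteq> {}" by force
  then obtain C D where CD: "(C, D) \<in> ?S Y" by (metis ex_in_conv surj_pair)
  then have CD: "verts Y = C \<union> D"
      "isomorphic (induced X A) (induced Y C)" "isomorphic (induced X B) (induced Y D)"
    using isomorphic_sym by (auto simp: split_pairs_def)
  have finCD: "finite C" "finite D" using sY CD by auto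
  \<comment> \<open>The sizes of \<open>C\<close> and \<open>D\<close> add up to \<open>n\<close>,
    the size of their union, which leaves no room for an overlap.\<close>
  have "card C + card D = card (C \<union> D)"
    using isomorphic_card_verts[OF CD(2)] isomorphic_card_verts[OF CD(3)] cardAB sY CD(1) by simp
  then have disj: "C \<inter> D = {}" using card_Un_Int[OF finCD] finCD by simp
  have simple: "simple_graph (induced X A)" "simple_graph (induced X B)"
      "simple_graph (induced Y C)" "simple_graph (induced Y D)"
    using sX sY AB CD by (auto intro!: simple_induced)
  \<comment> \<open>\<open>C\<close> and \<open>D\<close> together span as many edges as
    \<open>A\<close> and \<open>B\<close>, that is, as \<open>X\<close> has. Since \<open>Y\<close>
    has equally many edges, none joins \<open>C\<close> to \<open>D\<close>.\<close>
  have "card (edges (induced Y C) \<union> edges (induced Y D)) =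
      card (edges (induced Y C)) + card (edges (induced Y D))"
    by (intro card_Un_disjoint finite_edges simple edges_induced_disjoint[OF sY(1) disj])
  also have "\<dots> = card (edges (induced X A)) + card (edges (induced X B))"
    using isomorphic_card_edges[OF simple(1,3) CD(2)] isomorphic_card_edges[OF simple(2,4) CD(3)]
    by simp
  also have "\<dots> = card (edges X)"
    unfolding eX
    by (intro card_Un_disjoint[symmetric] finite_edges simple edges_induced_disjoint[OF sX(1) AB(3)])
  also have "\<dots> = card (edges Y)" by (rule deck_card_edges[OF X Y deck n])
  finally have "edges Y = edges (induced Y C) \<union> edges (induced Y D)"
    using finite_edges[OF sY(1)] by (intro card_subset_eq[symmetric]) (auto simp: edges_induced)
  with eX show ?thesis
    using isomorphic_glue[OF sX(1) AB(4,3) _ sY(1) CD(1) disj] CD(2,3) by blast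
qed

section \<open>Complements\<close>

definition complement :: "graph \<Rightarrow> graph" where
  "complement X = (verts X, {e. e \<subseteq> verts X \<and> card e = 2} - edges X)"

lemma verts_complement [simp]: "verts (complement X) = verts X"
  by (simp add: complement_def)

lemma complement_complement: "simple_graph X \<Longrightarrow> complement (complement X) = X"
  by (rule prod_eqI) (auto simp: complement_def simple_graph_def)

lemma simple_complement: "simple_graph X \<Longrightarrow> simple_graph (complement X)"
  by (auto simp: complement_def simple_graph_def)

text \<open>A bijection preserves distinctness as well as adjacency, hence also being a non-adjacent
  pair of distinct vertices.\<close>

lemma isomorphic_complement:
  assumes G: "simple_graph G" and H: "simple_graph H" and iso: "isomorphic G H"
  shows "isomorphic (complement G) (complement H)"
proof -
  obtain f where f: "bij_betw f (verts G) (verts H)"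
    "\<forall>u\<in>verts G. \<forall>v\<in>verts G. {u, v} \<in> edges G \<longleftrightarrow> {f u, f v} \<in> edges H"
    using iso unfolding isomorphic_def by blast
  have "{u, v} \<in> edges (complement G) \<longleftrightarrow> {f u, f v} \<in> edges (complement H)"
    if "u \<in> verts G" "v \<in> verts G" for u v
  proof -
    have "f u = f v \<longleftrightarrow> u = v" using f(1) that by (auto simp: bij_betw_def inj_on_def)
    moreover have "f u \<in> verts H" "f v \<in> verts H" using f(1) that by (auto dest: bij_betw_apply)
    ultimately show ?thesis using f(2) that by (auto simp: complement_def card_2_iff')
  qed
  with f(1) show ?thesis unfolding isomorphic_def by auto
qed

lemma delete_vertex_complement:
  "delete_vertex (complement X) v = complement (delete_vertex X v)"
  by (auto simp: delete_vertex_def complement_def)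

text \<open>Complementation respects isomorphism and is an involution on simple graphs, so each
  member of the left-hand class is the complement of a graph in the class of \<open>G\<close>,
  namely of its own complement.\<close>

lemma iso_class_complement:
  assumes G: "simple_graph G"
  shows "iso_class (complement G) = complement ` iso_class G"
proof (intro equalityI subsetI)
  fix H assume "H \<in> iso_class (complement G)"
  then have "simple_graph H" "isomorphic (complement G) H" by (auto simp: iso_class_def)
  then have "complement H \<in> iso_class G" "H = complement (complement H)"
    using isomorphic_complement[OF simple_complement[OF G], of H] G
    by (simp_all add: iso_class_def complement_complement simple_complement)
  then show "H \<in> complement ` iso_class G" by blast
next
  fix H assume "H \<in> complement ` iso_class G"
  then show "H \<in> iso_class (complement G)"
    using G by (auto simp del: split_paired_All split_paired_Ex
      simp: iso_class_def simple_complement isomorphic_complement)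
qed

text \<open>Deleting a vertex commutes with complementation. The deck of the complement is thereby a
  function of the deck, so equal decks stay equal.\<close>

lemma deck_complement:
  assumes X: "simple_graph X"
  shows "deck (complement X) = image_mset ((`) complement) (deck X)"
  unfolding deck_def using X
  by (simp add: image_mset.compositionality comp_def delete_vertex_complement
    iso_class_complement simple_delete_vertex)

lemma card_edges_complement:
  assumes "graph_on n X"
  shows "card (edges (complement X)) = (n choose 2) - card (edges X)"
proof -
  have X: "simple_graph X" "finite (verts X)" "card (verts X) = n"
    using assms by (auto simp: graph_on_def simple_graph_def)
  have "card ({e. e \<subseteq> verts X \<and> card e = 2} - edges X) =
      card {e. e \<subseteq> verts X \<and> card e = 2} - card (edges X)"
    using X by (intro card_Diff_subset finite_edges) (auto simp: simple_graph_def)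
  then show ?thesis using n_subsets[OF X(2), of 2] X by (simp add: complement_def)
qed

lemma graph_on_complement: "graph_on n X \<Longrightarrow> graph_on n (complement X)"
  by (simp add: graph_on_def simple_complement)

section \<open>Counting subgraphs\<close>

text \<open>Subgraphs here need not be induced. Edges of \<open>S\<close> are explicitly kept inside
  \<open>verts S\<close>, since \<open>isomorphic\<close> does not see edges leaving the vertex
  set.\<close>

definition copies :: "graph \<Rightarrow> graph \<Rightarrow> graph set" where
  "copies P X = {S. verts S \<subseteq> verts X \<and> edges S \<subseteq> edges X \<and>
     (\<forall>e\<in>edges S. e \<subseteq> verts S) \<and> isomorphic S P}"

text \<open>With the vertex set fixed, only the edge set remains to be chosen.\<close>

definition spanning_copies :: "graph \<Rightarrow> graph \<Rightarrow> nat set set set" where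
  "spanning_copies P X = {F \<in> Pow (edges X). isomorphic (verts X, F) P}"

lemma simple_subgraph:
  "simple_graph X \<Longrightarrow> verts S \<subseteq> verts X \<Longrightarrow> edges S \<subseteq> edges X \<Longrightarrow> \<forall>e\<in>edges S. e \<subseteq> verts S
    \<Longrightarrow> simple_graph S"
  by (auto simp: simple_graph_def intro: finite_subset)

lemma simple_spanning_subgraph: "simple_graph X \<Longrightarrow> F \<subseteq> edges X \<Longrightarrow> simple_graph (verts X, F)"
  by (auto simp: simple_graph_def)

text \<open>An isomorphism maps sets of edges bijectively to sets of edges, and the corresponding
  spanning subgraphs are isomorphic by the same vertex map.\<close>

lemma graph_invariant_card_spanning_copies: "graph_invariant (\<lambda>X. card (spanning_copies P X))"
  unfolding graph_invariant_def
proof (intro allI impI)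
  fix X Y assume "simple_graph X \<and> simple_graph Y \<and> isomorphic X Y"
  then have X: "simple_graph X" and Y: "simple_graph Y" and "isomorphic X Y" by auto
  then obtain f where f: "bij_betw f (verts X) (verts Y)" "edges Y = (`) f ` edges X"
    using isomorphic_iff_image[OF X Y] by blast
  have "bij_betw ((`) f) (edges X) (edges Y)"
    using inj_on_image_edges[OF X] f by (auto simp: bij_betw_def)
  then have "bij_betw ((`) ((`) f)) (Pow (edges X)) (Pow (edges Y))" by (rule bij_betw_Pow)
  then have "bij_betw ((`) ((`) f)) (spanning_copies P X) (spanning_copies P Y)"
    unfolding spanning_copies_def
  proof (rule bij_betw_Collect)
    fix F assume F: "F \<in> Pow (edges X)"
    have "simple_graph (verts X, F)" using simple_spanning_subgraph[OF X] F by blast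
    moreover have "simple_graph (verts Y, (`) f ` F)"
      using F f(2) by (intro simple_spanning_subgraph[OF Y]) auto
    ultimately have "isomorphic (verts X, F) (verts Y, (`) f ` F)"
      using isomorphic_iff_image[of "(verts X, F)" "(verts Y, (`) f ` F)"] f(1) by auto
    then show "isomorphic (verts Y, (`) f ` F) P \<longleftrightarrow> isomorphic (verts X, F) P"
      using isomorphic_cong by blast
  qed
  then show "card (spanning_copies P X) = card (spanning_copies P Y)" by (rule bij_betw_same_card)
qed

lemma finite_copies: "simple_graph X \<Longrightarrow> finite (copies P X)"
proof (rule finite_subset)
  show "copies P X \<subseteq> Pow (verts X) \<times> Pow (edges X)" by (auto simp: copies_def)
  show "simple_graph X \<Longrightarrow> finite (Pow (verts X) \<times> Pow (edges X))"
    using finite_edges by (simp add: simple_graph_def)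
qed

text \<open>Copies are sorted by their vertex set \<open>W\<close>; those on \<open>W\<close> are
  the spanning copies in \<open>induced X W\<close>, so Kelly's lemma applies. Every such
  \<open>W\<close> is proper because \<open>P\<close> has fewer than \<open>n\<close>
  vertices.\<close>

lemma deck_card_copies:
  assumes X: "graph_on n X" and Y: "graph_on n Y" and deck: "deck X = deck Y"
    and P: "card (verts P) < n"
  shows "card (copies P X) = card (copies P Y)"
proof -
  define g :: "graph \<Rightarrow> real" where "g G = of_nat (card (spanning_copies P G))" for G
  have g: "graph_invariant g"
    unfolding g_def by (intro graph_invariant_of_nat graph_invariant_card_spanning_copies)
  have "real (card (copies P X)) = (\<Sum>W\<in>Pow (verts X) - {verts X}. g (induced X W))"
    if X: "graph_on n X" for X
  proof -
    have fin: "finite (verts X)" and simple: "simple_graph X" and n: "card (verts X) = n"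
      using X by (auto simp: graph_on_def simple_graph_def)
    have "copies P X = (SIGMA W:Pow (verts X) - {verts X}. spanning_copies P (induced X W))"
      (is "_ = ?S")
    proof (intro equalityI subsetI)
      fix S assume S: "S \<in> copies P X"
      then have "isomorphic S P" by (simp add: copies_def)
      then have "verts S \<noteq> verts X" using isomorphic_card_verts n P by fastforce
      with S show "S \<in> ?S"
        by (cases S) (auto simp: copies_def spanning_copies_def edges_induced)
    qed (fastforce simp: copies_def spanning_copies_def edges_induced)
    then have "card (copies P X) =
        (\<Sum>W\<in>Pow (verts X) - {verts X}. card (spanning_copies P (induced X W)))"
      using fin by (simp add: spanning_copies_def finite_edges simple simple_induced)
    then show ?thesis by (simp add: g_def)
  qed
  from this[OF X] this[OF Y] kelly[OF g X Y deck] show ?thesis by simp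
qed

section \<open>The values of the polynomials\<close>

text \<open>This case is kept apart because by convention the value is the constant 1, whereas a
  graph has as many one-vertex subgraphs as vertices.\<close>

lemma P_value_one_vertex:
  assumes "simple_graph H" "card (verts H) = 1"
  shows "(P_value n H X :: 'k::field_char_0) = 1"
proof -
  have "Poly_Mapping.lookup (P_poly n H :: 'k polynomial) = (\<lambda>\<mu>. if \<mu> = 0 then 1 else 0)"
    using assms by (subst lookup_P_poly)
      (auto simp: no_isolated_vertex_def set_zero_above_def M_sum_def)
  then have "(P_poly n H :: 'k polynomial) = 1"
    by (intro poly_mapping_eqI) (simp add: lookup_one when_def)
  then show ?thesis by (simp add: P_value_def poly_value_def)
qed

text \<open>These index the terms of the double sum that survive the truncation at \<open>n\<close>
  and take the value 1 at the adjacency entries of \<open>X\<close>.\<close>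

definition P_support :: "nat \<Rightarrow> graph \<Rightarrow> graph \<Rightarrow> ((nat \<Rightarrow> nat) \<times> (nat \<Rightarrow> nat)) set" where
  "P_support n H X = {(r, \<sigma>). r \<in> increasing_seqs (card (verts H)) \<and>
     \<sigma> \<in> transversal (card (verts H)) (adj_entry H) \<and>
     (\<forall>(i, j)\<in>Poly_Mapping.keys (M_term (card (verts H)) (adj_entry H) r \<sigma>).
        i \<le> n \<and> j \<le> n \<and> {labeling X i, labeling X j} \<in> edges X)}"

text \<open>The coefficient of a monomial is the number of index pairs producing it, and the
  monomial evaluates to 0 or 1. The value is therefore a sum of fibre sizes of the map from index
  pairs to monomials.\<close>

lemma P_value_eq_card_support:
  assumes H: "simple_graph H" "no_isolated_vertex H" "card (verts H) \<noteq> 1"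
  shows "(P_value n H X :: 'k::field_char_0) = of_nat (card (P_support n H X))"
proof -
  let ?p = "P_poly n H :: 'k polynomial" and ?b = "\<lambda>v. of_nat (adj_entry X v) :: 'k"
  let ?m = "card (verts H)" and ?a = "adj_entry H"
  define bounded where "bounded \<mu> \<longleftrightarrow> (\<forall>(i, j)\<in>Poly_Mapping.keys \<mu>. i \<le> n \<and> j \<le> n)" for \<mu> :: monomial
  define good where
    "good \<mu> \<longleftrightarrow> (\<forall>(i, j)\<in>Poly_Mapping.keys \<mu>. {labeling X i, labeling X j} \<in> edges X)" for \<mu> :: monomial
  define \<phi> where "\<phi> = (\<lambda>(r, \<sigma>). M_term ?m ?a r \<sigma>)"
  let ?S = "P_support n H X"
  \<comment> \<open>All variables take the value 0 or 1 and exponents at keys are positive, so a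
    monomial has value 1 exactly when all its variables stand for edges of \<open>X\<close>.\<close>
  have val: "(\<Prod>v\<in>Poly_Mapping.keys \<mu>. ?b v ^ Poly_Mapping.lookup \<mu> v) = of_bool (good \<mu>)" for \<mu>
  proof (cases "good \<mu>")
    case True
    then have "?b v = 1" if "v \<in> Poly_Mapping.keys \<mu>" for v
      using that by (auto simp: good_def adj_entry_def split: prod.split)
    then show ?thesis using True by simp
  next
    case False
    then obtain v where v: "v \<in> Poly_Mapping.keys \<mu>" "?b v = 0"
      by (auto simp: good_def adj_entry_def)
    then have "?b v ^ Poly_Mapping.lookup \<mu> v = 0" by (simp add: in_keys_iff)
    then show ?thesis using False v(1) by (auto intro!: prod_zero)
  qed
  have lookup: "Poly_Mapping.lookup ?p \<mu> = (if bounded \<mu> then of_nat (card (M_index H \<mu>)) else 0)" for \<mu>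
    using H(3) by (simp add: lookup_P_poly[OF H(1,2)] set_zero_above_def M_sum_def bounded_def)
  \<comment> \<open>Whether a term survives depends on its monomial alone, so the support contains
    all terms with a given monomial or none.\<close>
  have fiber: "{x \<in> ?S. \<phi> x = \<mu>} = M_index H \<mu>" if "bounded \<mu>" "good \<mu>" for \<mu>
    using that by (auto simp: P_support_def M_index_def Let_def \<phi>_def bounded_def good_def)
  have S: "bounded (\<phi> x)" "good (\<phi> x)" "x \<in> M_index H (\<phi> x)" if "x \<in> ?S" for x
    using that by (auto simp: P_support_def M_index_def Let_def \<phi>_def bounded_def good_def)
  have sub: "\<phi> ` ?S \<subseteq> Poly_Mapping.keys ?p"
  proof
    fix \<mu> assume "\<mu> \<in> \<phi> ` ?S"
    then obtain x where x: "x \<in> ?S" "\<mu> = \<phi> x" by blast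
    \<comment> \<open>The count is finite and positive, and in characteristic 0 it stays nonzero in
      the field, so the monomial does occur in the polynomial.\<close>
    then have "card (M_index H \<mu>) \<noteq> 0" using S(3)[OF x(1)] finite_M_index[OF H, of \<mu>] by auto
    then show "\<mu> \<in> Poly_Mapping.keys ?p" using S(1)[OF x(1)] x by (simp add: in_keys_iff lookup)
  qed
  have "?S = (\<Union>\<mu>\<in>\<phi> ` ?S. M_index H \<mu>)" using S fiber by blast
  moreover have "finite (\<phi> ` ?S)" using sub by (rule finite_subset) simp
  ultimately have fin: "finite ?S" by (metis finite_M_index[OF H] finite_UN_I)
  have "P_value n H X = (\<Sum>\<mu>\<in>Poly_Mapping.keys ?p. Poly_Mapping.lookup ?p \<mu> * of_bool (good \<mu>))"
    by (simp add: P_value_def poly_value_def val)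
  also have "\<dots> = (\<Sum>\<mu>\<in>\<phi> ` ?S. of_nat (card (M_index H \<mu>)))"
  proof (rule sum.mono_neutral_cong_right)
    show "\<forall>\<mu>\<in>Poly_Mapping.keys ?p - \<phi> ` ?S. Poly_Mapping.lookup ?p \<mu> * of_bool (good \<mu>) = 0"
    proof
      fix \<mu> assume \<mu>: "\<mu> \<in> Poly_Mapping.keys ?p - \<phi> ` ?S"
      then have "{x \<in> ?S. \<phi> x = \<mu>} = {}" by blast
      then have "M_index H \<mu> = {}" if "bounded \<mu>" "good \<mu>" using fiber[OF that] by simp
      then show "Poly_Mapping.lookup ?p \<mu> * of_bool (good \<mu>) = 0"
        by (auto simp: lookup simp del: card_eq_0_iff)
    qed
    show "Poly_Mapping.lookup ?p \<mu> * of_bool (good \<mu>) = of_nat (card (M_index H \<mu>))"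
      if "\<mu> \<in> \<phi> ` ?S" for \<mu>
      using that S by (auto simp: lookup)
  qed (use sub in simp_all)
  also have "\<dots> = of_nat (\<Sum>\<mu>\<in>\<phi> ` ?S. card {x \<in> ?S. \<phi> x = \<mu>})"
    unfolding of_nat_sum using fiber S by (intro sum.cong refl) auto
  also have "(\<Sum>\<mu>\<in>\<phi> ` ?S. card {x \<in> ?S. \<phi> x = \<mu>}) = card ?S"
    using sum.image_gen[OF fin, of "\<lambda>_. 1::nat" \<phi>] by simp
  finally show ?thesis .
qed

text \<open>\<open>u\<close> places the vertices of \<open>H\<close>, which are enumerated by \<open>c\<close>.\<close>

definition placed_copy :: "nat \<Rightarrow> graph \<Rightarrow> (nat \<Rightarrow> nat) \<Rightarrow> (nat \<Rightarrow> nat) \<Rightarrow> graph" where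
  "placed_copy m H c u = (u ` {1..m},
     (\<lambda>(i, j). {u i, u j}) ` {(i, j) \<in> index_pairs m. {c i, c j} \<in> edges H})"

lemma verts_placed_copy [simp]: "verts (placed_copy m H c u) = u ` {1..m}"
  by (simp add: placed_copy_def)

text \<open>\<open>index_pairs\<close> lists each pair once, in increasing order; edges being
  unordered and \<open>u\<close> injective, the criterion extends to any two indices.\<close>

lemma edges_placed_copy_iff:
  assumes H: "simple_graph H" and c: "inj_on c {1..m}" and u: "inj_on u {1..m}"
    and ij: "i \<in> {1..m}" "j \<in> {1..m}"
  shows "{u i, u j} \<in> edges (placed_copy m H c u) \<longleftrightarrow> {c i, c j} \<in> edges H"
proof
  assume "{u i, u j} \<in> edges (placed_copy m H c u)"
  then obtain k l where kl: "(k, l) \<in> index_pairs m" "{c k, c l} \<in> edges H" "{u i, u j} = {u k, u l}"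
    by (auto simp: placed_copy_def)
  then have "k \<in> {1..m}" "l \<in> {1..m}" by (auto simp: index_pairs_def)
  then have "i = k \<and> j = l \<or> i = l \<and> j = k"
    using kl(3) u ij by (auto simp: doubleton_eq_iff dest: inj_onD)
  then show "{c i, c j} \<in> edges H" using kl(2) by (auto simp: insert_commute)
next
  assume e: "{c i, c j} \<in> edges H"
  then have "i \<noteq> j" using H by (auto simp: simple_graph_def)
  then consider "(i, j) \<in> index_pairs m" | "(j, i) \<in> index_pairs m"
    using ij by (force simp: index_pairs_def)
  then show "{u i, u j} \<in> edges (placed_copy m H c u)"
  proof cases
    case 1
    then show ?thesis using e by (auto simp: placed_copy_def intro!: image_eqI[of _ _ "(i, j)"])
  next
    case 2
    then show ?thesis using e
      by (auto simp: placed_copy_def insert_commute intro!: image_eqI[of _ _ "(j, i)"])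
  qed
qed

text \<open>The isomorphism sends the vertex \<open>c i\<close> to \<open>u i\<close>.\<close>

lemma isomorphic_placed_copy:
  assumes H: "simple_graph H" and c: "bij_betw c {1..m} (verts H)" and u: "inj_on u {1..m}"
  shows "isomorphic H (placed_copy m H c u)"
proof -
  let ?g = "inv_into {1..m} c"
  have g: "bij_betw ?g (verts H) {1..m}" by (rule bij_betw_inv_into[OF c])
  have "bij_betw (u \<circ> ?g) (verts H) (u ` {1..m})"
    by (rule bij_betw_trans[OF g bij_betw_imageI[OF u refl]])
  moreover have "{x, y} \<in> edges H \<longleftrightarrow> {(u \<circ> ?g) x, (u \<circ> ?g) y} \<in> edges (placed_copy m H c u)"
    if "x \<in> verts H" "y \<in> verts H" for x y
    using edges_placed_copy_iff[OF H _ u, of c "?g x" "?g y"] c that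
      bij_betw_inv_into_right[OF c] bij_betw_apply[OF g] by (simp add: bij_betw_def)
  ultimately show ?thesis unfolding isomorphic_def by auto
qed

section \<open>Increasing index sequences as finite sets\<close>

text \<open>The values at 1 to \<open>m\<close> form a strictly sorted list, which is determined by
  its set of elements.\<close>

lemma strict_mono_on_same_image:
  fixes r r' :: "nat \<Rightarrow> nat"
  assumes "strict_mono_on {1..m} r" "strict_mono_on {1..m} r'" "r ` {1..m} = r' ` {1..m}"
    and k: "k \<in> {1..m}"
  shows "r k = r' k"
proof -
  have "sorted_wrt (<) (map f [1..<Suc m])" if "strict_mono_on {1..m} f" for f :: "nat \<Rightarrow> nat"
    using that by (auto simp: sorted_wrt_iff_nth_less strict_mono_on_def simp del: upt_Suc)
  moreover have "set (map f [1..<Suc m]) = f ` {1..m}" for f :: "nat \<Rightarrow> nat"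
    by (simp del: upt_Suc add: atLeastLessThanSuc_atLeastAtMost)
  ultimately have "map r [1..<Suc m] = map r' [1..<Suc m]"
    using assms(1-3) by (intro sorted_distinct_set_unique)
      (simp_all del: upt_Suc add: strict_sorted_iff)
  then show ?thesis using k by (simp del: upt_Suc)
qed

lemma obtain_increasing_seq:
  assumes "finite A" "A \<subseteq> {0<..}"
  obtains r where "r \<in> increasing_seqs (card A)" "r ` {1..card A} = A"
proof -
  obtain h where h: "bij_betw h {..<card A} A" "strict_mono_on {..<card A} h"
    using ex_bij_betw_strict_mono_card[OF assms(1)] by blast
  \<comment> \<open>\<open>h\<close> counts from 0 but sequences from 1, hence the shift; the
    restriction makes \<open>r\<close> extensional, as \<open>increasing_seqs\<close>
    demands.\<close>
  define r where "r = (\<lambda>k\<in>{1..card A}. h (k - 1))"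
  have "(\<lambda>k. k - 1) ` {1..card A} = {..<card A}"
    by (force intro: image_eqI[of _ _ "Suc _"])
  then have im: "r ` {1..card A} = A"
    using h(1) by (metis (mono_tags, lifting) bij_betw_def image_cong image_image r_def restrict_apply')
  have "strict_mono_on {1..card A} r"
    by (auto simp: r_def intro!: strict_mono_onI strict_mono_onD[OF h(2)])
  moreover have "r \<in> {1..card A} \<rightarrow>\<^sub>E {0<..}"
    using im assms(2) by (auto simp: r_def)
  ultimately show thesis using im that by (auto simp: increasing_seqs_def)
qed

section \<open>Terms of the formal sum versus subgraphs\<close>

text \<open>Sorting a pair by \<open>min\<close> and \<open>max\<close> is invisible in an unordered
  edge, so the action simply precomposes the labeling with \<sigma>.\<close>

lemma adj_entry_pair_act:
  "adj_entry G (pair_act \<sigma> (i, j)) =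
    of_bool ({labeling G (\<sigma> i), labeling G (\<sigma> j)} \<in> edges G)"
  by (auto simp: adj_entry_def pair_act_def min_def max_def insert_commute)

lemma permuted_family_eq_iff:
  "permuted_family m (adj_entry G) \<sigma> = permuted_family m (adj_entry G) \<tau> \<longleftrightarrow>
    (\<forall>(i, j)\<in>index_pairs m. {labeling G (\<sigma> i), labeling G (\<sigma> j)} \<in> edges G \<longleftrightarrow>
       {labeling G (\<tau> i), labeling G (\<tau> j)} \<in> edges G)" (is "?L \<longleftrightarrow> ?R")
proof -
  have "?L \<longleftrightarrow> (\<forall>p\<in>index_pairs m. adj_entry G (pair_act \<sigma> p) = adj_entry G (pair_act \<tau> p))"
    unfolding permuted_family_def by (auto simp: fun_eq_iff restrict_def)
  also have "\<dots> \<longleftrightarrow> ?R"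
    by (intro ball_cong refl) (auto simp: adj_entry_pair_act of_bool_def split: if_splits)
  finally show ?thesis .
qed

text \<open>The sequence \<open>r\<close> selects the vertices of the copy and \<sigma> selects how
  \<open>H\<close> is laid on them. On fixed vertices, two permutations give the same edge set
  exactly when their permuted families agree, so a transversal produces each copy exactly
  once.\<close>

lemma card_copies_eq_card_support:
  assumes H: "simple_graph H" "no_isolated_vertex H" "card (verts H) \<noteq> 1"
    and X: "graph_on n X"
  shows "card (P_support n H X) = card (copies H X)"
proof -
  let ?m = "card (verts H)" and ?a = "adj_entry H" and ?t = "labeling X" and ?s = "labeling H"
  let ?I = "{1..card (verts H)}"
  define \<Psi> where "\<Psi> = (\<lambda>(r, \<sigma>). placed_copy ?m H (?s \<circ> \<sigma>) (?t \<circ> r))"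
  have sX: "simple_graph X" and nX: "card (verts X) = n" using X by (auto simp: graph_on_def)
  have t: "bij_betw ?t {1..n} (verts X)" using labeling_bij[OF sX] nX by simp
  then have inj_t: "inj_on ?t {1..n}" by (simp add: bij_betw_def)
  have s: "bij_betw ?s ?I (verts H)" by (rule labeling_bij[OF H(1)])
  have R: "is_transversal ?m ?a (transversal ?m ?a)" by (rule transversal)
  have perm: "\<sigma> permutes ?I" if "\<sigma> \<in> transversal ?m ?a" for \<sigma>
    using R that by (auto simp: is_transversal_def)
  have c: "bij_betw (?s \<circ> \<sigma>) ?I (verts H)" if "\<sigma> permutes ?I" for \<sigma>
    by (rule bij_betw_trans[OF permutes_imp_bij[OF that] s])
  have keys: "Poly_Mapping.keys (M_term ?m ?a r \<sigma>) =
      (\<lambda>(i, j). (r i, r j)) ` {(i, j) \<in> index_pairs ?m. {(?s \<circ> \<sigma>) i, (?s \<circ> \<sigma>) j} \<in> edges H}" for r \<sigma>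
    using keys_M_term[of ?m ?a r \<sigma>] lookup_M_term[of _ _ ?m ?a \<sigma> r]
    by (fastforce simp: adj_entry_pair_act)
  have support: "(r, \<sigma>) \<in> P_support n H X \<longleftrightarrow> r \<in> increasing_seqs ?m \<and> \<sigma> \<in> transversal ?m ?a \<and>
      r ` ?I \<subseteq> {1..n} \<and> edges (\<Psi> (r, \<sigma>)) \<subseteq> edges X" (is "?L \<longleftrightarrow> ?R") for r \<sigma>
  proof
    assume L: ?L
    then have r: "r \<in> increasing_seqs ?m" and \<sigma>: "\<sigma> \<in> transversal ?m ?a" by (auto simp: P_support_def)
    \<comment> \<open>Without isolated vertices in \<open>H\<close>, every \<open>r k\<close> is an
      index of some variable of the monomial, so the truncation bounds the whole sequence.\<close>
    have "r k \<in> {1..n}" if k: "k \<in> ?I" for k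
    proof -
      have "r k \<le> n"
        using M_term_covers[OF H perm[OF \<sigma>] k, of r] L by (fastforce simp: P_support_def)
      moreover have "r k > 0" using r k by (auto simp: increasing_seqs_def)
      ultimately show ?thesis by simp
    qed
    moreover have "edges (\<Psi> (r, \<sigma>)) \<subseteq> edges X"
      using L unfolding P_support_def keys \<Psi>_def placed_copy_def by auto
    ultimately show ?R using r \<sigma> by blast
  next
    assume R: ?R
    have "i \<le> n \<and> j \<le> n \<and> {?t i, ?t j} \<in> edges X"
      if ij: "(i, j) \<in> Poly_Mapping.keys (M_term ?m ?a r \<sigma>)" for i j
    proof -
      obtain k l where kl: "i = r k" "j = r l" "(k, l) \<in> index_pairs ?m"
          "{(?s \<circ> \<sigma>) k, (?s \<circ> \<sigma>) l} \<in> edges H"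
        using ij unfolding keys by auto
      then have "{(?t \<circ> r) k, (?t \<circ> r) l} \<in> edges (\<Psi> (r, \<sigma>))"
        unfolding \<Psi>_def placed_copy_def by force
      moreover have "k \<in> ?I" "l \<in> ?I" using kl(3) by (auto simp: index_pairs_def)
      moreover from this have "r k \<in> {1..n}" "r l \<in> {1..n}" using R by blast+
      ultimately show ?thesis using R kl(1,2) by auto
    qed
    with R show ?L by (auto simp: P_support_def)
  qed
  have u: "inj_on (?t \<circ> r) ?I" if "r \<in> increasing_seqs ?m" "r ` ?I \<subseteq> {1..n}" for r
  proof (rule comp_inj_on)
    show "inj_on r ?I" using that(1) by (auto simp: increasing_seqs_def intro: strict_mono_on_imp_inj_on)
    show "inj_on ?t (r ` ?I)" using inj_t that(2) by (rule inj_on_subset)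
  qed
  have "inj_on \<Psi> (P_support n H X)"
  proof (rule inj_onI)
    fix x y assume x: "x \<in> P_support n H X" and y: "y \<in> P_support n H X" and eq: "\<Psi> x = \<Psi> y"
    obtain r \<sigma> r' \<sigma>' where xy: "x = (r, \<sigma>)" "y = (r', \<sigma>')" by (cases x, cases y)
    have r: "r \<in> increasing_seqs ?m" "r ` ?I \<subseteq> {1..n}" and r': "r' \<in> increasing_seqs ?m" "r' ` ?I \<subseteq> {1..n}"
      and \<sigma>: "\<sigma> \<in> transversal ?m ?a" and \<sigma>': "\<sigma>' \<in> transversal ?m ?a"
      using x y by (auto simp: xy support)
    \<comment> \<open>The vertex set of the copy determines the image of \<open>r\<close>, and an
      increasing sequence is determined by its image.\<close>
    have "?t ` r ` ?I = ?t ` r' ` ?I"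
      using arg_cong[OF eq, of verts] by (simp add: xy \<Psi>_def image_comp)
    then have im: "r ` ?I = r' ` ?I" using inj_on_image_eq_iff[OF inj_t r(2) r'(2)] by simp
    have "r = r'"
    proof
      fix k
      show "r k = r' k"
      proof (cases "k \<in> ?I")
        case True
        then show ?thesis
          using strict_mono_on_same_image[of ?m r r'] im r(1) r'(1) by (auto simp: increasing_seqs_def)
      next
        case False
        then show ?thesis using r(1) r'(1) by (auto simp: increasing_seqs_def PiE_iff extensional_def)
      qed
    qed
    \<comment> \<open>Once \<open>r\<close> is known, the edge set of the copy reveals the permuted
      family, and the transversal contains only one permutation for it.\<close>
    have edge: "{(?t \<circ> r) i, (?t \<circ> r) j} \<in> edges (placed_copy ?m H (?s \<circ> \<tau>) (?t \<circ> r)) \<longleftrightarrow>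
        {(?s \<circ> \<tau>) i, (?s \<circ> \<tau>) j} \<in> edges H"
      if "\<tau> \<in> transversal ?m ?a" "i \<in> ?I" "j \<in> ?I" for \<tau> i j
      using c[OF perm[OF that(1)]]
      by (intro edges_placed_copy_iff[OF H(1) _ u[OF r] that(2,3)]) (simp add: bij_betw_def)
    have "placed_copy ?m H (?s \<circ> \<sigma>) (?t \<circ> r) = placed_copy ?m H (?s \<circ> \<sigma>') (?t \<circ> r)"
      using eq \<open>r = r'\<close> by (simp add: xy \<Psi>_def)
    then have "{(?s \<circ> \<sigma>) i, (?s \<circ> \<sigma>) j} \<in> edges H \<longleftrightarrow> {(?s \<circ> \<sigma>') i, (?s \<circ> \<sigma>') j} \<in> edges H"
      if "i \<in> ?I" "j \<in> ?I" for i j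
      using edge[OF \<sigma> that] edge[OF \<sigma>' that] by simp
    then have "permuted_family ?m ?a \<sigma> = permuted_family ?m ?a \<sigma>'"
      unfolding permuted_family_eq_iff by (auto simp: index_pairs_def)
    then have "\<sigma> = \<sigma>'"
      using R \<sigma> \<sigma>' by (auto simp: is_transversal_def dest: inj_onD)
    with \<open>r = r'\<close> show "x = y" by (simp add: xy)
  qed
  moreover have "\<Psi> ` P_support n H X = copies H X"
  proof (intro equalityI subsetI)
    fix S assume "S \<in> \<Psi> ` P_support n H X"
    then obtain r \<sigma> where S: "S = \<Psi> (r, \<sigma>)" and sup: "(r, \<sigma>) \<in> P_support n H X" by auto
    have r: "r \<in> increasing_seqs ?m" "r ` ?I \<subseteq> {1..n}" and \<sigma>: "\<sigma> \<in> transversal ?m ?a"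
      using sup by (auto simp: support)
    have "verts S = ?t ` r ` ?I" by (simp add: S \<Psi>_def image_comp)
    also have "\<dots> \<subseteq> verts X" using image_mono[OF r(2), of ?t] t by (simp add: bij_betw_def)
    finally have "verts S \<subseteq> verts X" .
    moreover have "edges S \<subseteq> edges X" using sup by (auto simp: S support)
    moreover have "\<forall>e\<in>edges S. e \<subseteq> verts S"
      by (auto simp: S \<Psi>_def placed_copy_def index_pairs_def)
    moreover have "isomorphic S H"
      using isomorphic_placed_copy[OF H(1) c[OF perm[OF \<sigma>]] u[OF r]]
      by (simp add: S \<Psi>_def isomorphic_sym)
    ultimately show "S \<in> copies H X" by (simp add: copies_def)
  next
    fix S assume "S \<in> copies H X"
    then have S: "verts S \<subseteq> verts X" "edges S \<subseteq> edges X" "\<forall>e\<in>edges S. e \<subseteq> verts S"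
      and iso: "isomorphic S H" by (auto simp: copies_def)
    obtain f where f: "bij_betw f (verts S) (verts H)"
        "\<forall>u\<in>verts S. \<forall>v\<in>verts S. {u, v} \<in> edges S \<longleftrightarrow> {f u, f v} \<in> edges H"
      using iso unfolding isomorphic_def by blast
    \<comment> \<open>The labels in \<open>X\<close> of the vertices of \<open>S\<close>; their
      increasing enumeration will be \<open>r\<close>.\<close>
    define A where "A = {k \<in> {1..n}. ?t k \<in> verts S}"
    have tA: "?t ` A = verts S"
    proof (intro equalityI subsetI)
      fix v assume v: "v \<in> verts S"
      then have "v \<in> ?t ` {1..n}" using S(1) t by (auto simp: bij_betw_def)
      with v show "v \<in> ?t ` A" by (auto simp: A_def)
    qed (auto simp: A_def)
    have A: "A \<subseteq> {1..n}" "finite A" by (auto simp: A_def)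
    have "card A = card (verts S)"
      using card_image[OF inj_on_subset[OF inj_t A(1)]] tA by simp
    then have cardA: "card A = ?m" using isomorphic_card_verts[OF iso] by simp
    have "A \<subseteq> {0<..}" using A(1) by auto
    then obtain r where r: "r \<in> increasing_seqs ?m" "r ` ?I = A"
      using obtain_increasing_seq[OF A(2)] unfolding cardA by blast
    let ?u = "?t \<circ> r"
    have rn: "r ` ?I \<subseteq> {1..n}" using r(2) A(1) by simp
    have u': "bij_betw ?u ?I (verts S)"
      using u[OF r(1) rn] by (rule bij_betw_imageI) (simp only: image_comp[symmetric] r(2) tA)
    have si: "bij_betw (inv_into ?I ?s) (verts H) ?I" by (rule bij_betw_inv_into[OF s])
    \<comment> \<open>The i-th vertex of \<open>S\<close> corresponds under \<open>f\<close> to a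
      vertex of \<open>H\<close>, and \<pi> gives the label of that vertex. It is the identity
      elsewhere, as \<open>permutes\<close> requires.\<close>
    define \<pi> where "\<pi> i = (if i \<in> ?I then inv_into ?I ?s (f (?u i)) else i)" for i
    have "bij_betw (inv_into ?I ?s \<circ> (f \<circ> ?u)) ?I ?I"
      by (rule bij_betw_trans[OF bij_betw_trans[OF u' f(1)] si])
    then have "bij_betw \<pi> ?I ?I" by (rule bij_betw_cong[THEN iffD1, rotated]) (simp add: \<pi>_def)
    then have "\<pi> permutes ?I" by (rule bij_imp_permutes) (simp only: \<pi>_def if_False)
    \<comment> \<open>\<pi> itself may be missing from the transversal; the representative \<sigma>
      of its family yields the same edges.\<close>
    then have "permuted_family ?m ?a \<pi> \<in> permuted_family ?m ?a ` transversal ?m ?a"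
      using R unfolding is_transversal_def by blast
    then obtain \<sigma> where \<sigma>: "\<sigma> \<in> transversal ?m ?a"
        "permuted_family ?m ?a \<pi> = permuted_family ?m ?a \<sigma>" by blast
    have s\<pi>: "?s (\<pi> i) = f (?u i)" if "i \<in> ?I" for i
      using that bij_betw_inv_into_right[OF s] bij_betw_apply[OF f(1) bij_betw_apply[OF u' that]]
      by (simp add: \<pi>_def)
    have edge: "{(?s \<circ> \<sigma>) i, (?s \<circ> \<sigma>) j} \<in> edges H \<longleftrightarrow> {?u i, ?u j} \<in> edges S"
      if ij: "(i, j) \<in> index_pairs ?m" for i j
    proof -
      have I: "i \<in> ?I" "j \<in> ?I" using ij by (auto simp: index_pairs_def)
      have "{?s (\<pi> i), ?s (\<pi> j)} \<in> edges H \<longleftrightarrow> {?s (\<sigma> i), ?s (\<sigma> j)} \<in> edges H"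
        using \<sigma>(2) ij unfolding permuted_family_eq_iff by blast
      moreover have "?u i \<in> verts S" "?u j \<in> verts S" using bij_betw_apply[OF u'] I by auto
      ultimately show ?thesis using f(2) s\<pi>[OF I(1)] s\<pi>[OF I(2)] by auto
    qed
    have "edges (\<Psi> (r, \<sigma>)) = edges S"
    proof (intro equalityI subsetI)
      fix e assume "e \<in> edges (\<Psi> (r, \<sigma>))"
      then obtain i j where "(i, j) \<in> index_pairs ?m" "{(?s \<circ> \<sigma>) i, (?s \<circ> \<sigma>) j} \<in> edges H"
          "e = {?u i, ?u j}"
        unfolding \<Psi>_def placed_copy_def by auto
      then show "e \<in> edges S" using edge by simp
    next
      fix e assume e: "e \<in> edges S"
      then have "card e = 2" using S(2) sX by (auto simp: simple_graph_def)
      then obtain x y where xy: "e = {x, y}" "x \<noteq> y" by (auto simp: card_2_iff)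
      then have "x \<in> ?u ` ?I" "y \<in> ?u ` ?I" using e S(3) u' by (auto simp: bij_betw_def)
      then obtain i j where ij: "i \<in> ?I" "j \<in> ?I" "x = ?u i" "y = ?u j" by blast
      with xy(2) have "i < j \<or> j < i" by (metis linorder_neqE_nat)
      then obtain k l where kl: "(k, l) \<in> index_pairs ?m" "e = {?u k, ?u l}"
        using ij xy(1) by (auto simp: index_pairs_def insert_commute)
      then have "(k, l) \<in> {(i, j) \<in> index_pairs ?m. {(?s \<circ> \<sigma>) i, (?s \<circ> \<sigma>) j} \<in> edges H}"
        using edge e by simp
      then show "e \<in> edges (\<Psi> (r, \<sigma>))"
        unfolding \<Psi>_def placed_copy_def using kl(2) by (auto intro!: image_eqI[of _ _ "(k, l)"])
    qed
    moreover have "verts (\<Psi> (r, \<sigma>)) = verts S"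
      using u' by (simp add: \<Psi>_def bij_betw_def)
    ultimately have "S = \<Psi> (r, \<sigma>)" by (simp add: prod_eq_iff)
    moreover have "(r, \<sigma>) \<in> P_support n H X"
      using r(1) \<sigma>(1) rn S(2) \<open>edges (\<Psi> (r, \<sigma>)) = edges S\<close> by (simp add: support)
    ultimately show "S \<in> \<Psi> ` P_support n H X" by blast
  qed
  ultimately show ?thesis by (metis card_image)
qed

lemma P_value_eq_card_copies:
  assumes "simple_graph H" "no_isolated_vertex H" "card (verts H) \<noteq> 1" "graph_on n X"
  shows "(P_value n H X :: 'k::field_char_0) = of_nat (card (copies H X))"
  unfolding card_copies_eq_card_support[OF assms, symmetric]
  by (rule P_value_eq_card_support[OF assms(1-3)])

lemma deck_P_value:
  assumes X: "graph_on n X" and Y: "graph_on n Y" and deck: "deck X = deck Y"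
    and H: "simple_graph H" "no_isolated_vertex H" "card (verts H) < n"
  shows "(P_value n H X :: 'k::field_char_0) = P_value n H Y"
proof (cases "card (verts H) = 1")
  case True
  then show ?thesis by (simp add: P_value_one_vertex[OF H(1)])
next
  case False
  then show ?thesis
    by (simp add: P_value_eq_card_copies[OF H(1,2)] X Y deck_card_copies[OF X Y deck H(3)])
qed

section \<open>Reconstruction\<close>

text \<open>A path from \<open>v\<close> to any other vertex starts with an edge at
  \<open>v\<close>.\<close>

lemma connected_no_isolated_vertex:
  assumes X: "simple_graph X" "connected_graph X" "card (verts X) \<ge> 2"
  shows "no_isolated_vertex X"
proof -
  have "\<exists>e\<in>edges X. v \<in> e" if v: "v \<in> verts X" for v
  proof -
    have "\<not> verts X \<subseteq> {v}" using X(3) card_mono[of "{v}" "verts X"] by auto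
    then obtain w where w: "w \<in> verts X" "w \<noteq> v" by blast
    then have "(v, w) \<in> {(x, y). {x, y} \<in> edges X}\<^sup>*"
      using X(2) v by (auto simp: connected_graph_def)
    then show ?thesis
      by (rule converse_rtranclE) (use w in auto)
  qed
  with X(3) show ?thesis by (simp add: no_isolated_vertex_def)
qed

text \<open>A copy of \<open>X\<close> inside \<open>Y\<close> has as many vertices and edges as
  \<open>Y\<close>, so by finiteness it is all of \<open>Y\<close>.\<close>

lemma isomorphic_if_copy:
  assumes X: "graph_on n X" and Y: "graph_on n Y" and card: "card (edges X) = card (edges Y)"
    and S: "S \<in> copies X Y"
  shows "isomorphic X Y"
proof -
  have sX: "simple_graph X" and sY: "simple_graph Y" "finite (verts Y)"
    using X Y by (auto simp: graph_on_def simple_graph_def)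
  have S: "verts S \<subseteq> verts Y" "edges S \<subseteq> edges Y" "isomorphic S X" "simple_graph S"
    using S simple_subgraph[OF sY(1)] by (auto simp: copies_def)
  have "verts S = verts Y"
    using isomorphic_card_verts[OF S(3)] X Y S(1) sY(2)
    by (intro card_subset_eq) (auto simp: graph_on_def)
  moreover have "edges S = edges Y"
    using isomorphic_card_edges[OF S(4) sX S(3)] card S(2) finite_edges[OF sY(1)]
    by (intro card_subset_eq) auto
  ultimately have "S = Y" by (simp add: prod_eq_iff)
  with S(3) show ?thesis by (simp add: isomorphic_sym)
qed

theorem proposition5p2:
  fixes n :: nat
  assumes "n \<ge> 3"
    and "\<And>X Y. graph_on n X \<Longrightarrow> graph_on n Y \<Longrightarrow>
      (\<forall>H. simple_graph H \<and> no_isolated_vertex H \<and> card (verts H) \<le> n - 1 \<longrightarrow>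
        (P_value n H X :: 'k::field_char_0) = P_value n H Y) \<Longrightarrow>
      (\<forall>G. graph_on n G \<and> connected_graph G \<and> card (edges G) \<le> (n choose 2) div 2 \<longrightarrow>
        (P_value n G X :: 'k) = P_value n G Y)"
  shows "reconstructible n"
proof -
  have sparse: "isomorphic X Y"
    if X: "graph_on n X" and Y: "graph_on n Y" and deck: "deck X = deck Y"
      and few: "card (edges X) \<le> (n choose 2) div 2" for X Y
  proof (cases "connected_graph X")
    case False
    then show ?thesis using disconnected_reconstructible[OF X Y deck assms(1)] by simp
  next
    case True
    have sX: "simple_graph X" "card (verts X) = n" using X by (auto simp: graph_on_def)
    then have iso: "no_isolated_vertex X" "card (verts X) \<noteq> 1"
      using connected_no_isolated_vertex[OF _ True] assms(1) by auto
    have "\<forall>H. simple_graph H \<and> no_isolated_vertex H \<and> card (verts H) \<le> n - 1 \<longrightarrow>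
        (P_value n H X :: 'k) = P_value n H Y"
    proof (intro allI impI)
      fix H assume "simple_graph H \<and> no_isolated_vertex H \<and> card (verts H) \<le> n - 1"
      then show "(P_value n H X :: 'k) = P_value n H Y"
        using assms(1) by (intro deck_P_value[OF X Y deck]) auto
    qed
    \<comment> \<open>The connected graph \<open>X\<close> itself serves as the graph
      \<open>G\<close> of the hypothesis.\<close>
    then have "(P_value n X X :: 'k) = P_value n X Y"
      using assms(2)[OF X Y] X True few by blast
    then have "card (copies X X) = card (copies X Y)"
      using P_value_eq_card_copies[OF sX(1) iso X, where 'k = 'k]
        P_value_eq_card_copies[OF sX(1) iso Y, where 'k = 'k] by simp
    moreover have "X \<in> copies X X"
      using sX(1) by (auto simp: copies_def simple_graph_def isomorphic_refl)
    ultimately have "copies X Y \<noteq> {}"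
      using finite_copies[OF sX(1), of X] by (metis card_0_eq card.empty empty_iff)
    then obtain S where "S \<in> copies X Y" by (meson ex_in_conv)
    then show ?thesis
      by (rule isomorphic_if_copy[OF X Y deck_card_edges[OF X Y deck assms(1)]])
  qed
  show ?thesis
    unfolding reconstructible_def
  proof (intro allI impI)
    fix X Y assume "graph_on n X \<and> graph_on n Y \<and> deck X = deck Y"
    then have X: "graph_on n X" and Y: "graph_on n Y" and deck: "deck X = deck Y" by auto
    have sX: "simple_graph X" and sY: "simple_graph Y" using X Y by (auto simp: graph_on_def)
    show "isomorphic X Y"
    proof (cases "card (edges X) \<le> (n choose 2) div 2")
      case True
      then show ?thesis by (rule sparse[OF X Y deck])
    next
      case False
      have "isomorphic (complement X) (complement Y)"
      proof (rule sparse[OF graph_on_complement[OF X] graph_on_complement[OF Y]])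
        show "deck (complement X) = deck (complement Y)"
          by (simp add: deck_complement sX sY deck)
        \<comment> \<open>Removing more than the rounded-down half of all pairs leaves at most that
          half, also when the number of pairs is odd.\<close>
        show "card (edges (complement X)) \<le> (n choose 2) div 2"
          using False unfolding card_edges_complement[OF X] by linarith
      qed
      then have "isomorphic (complement (complement X)) (complement (complement Y))"
        by (rule isomorphic_complement[OF simple_complement[OF sX] simple_complement[OF sY]])
      then show ?thesis by (simp add: complement_complement sX sY)
    qed
  qed
qed

end
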